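(* Let $\ell\ge 3$, and let $R'\subseteq R_\ell$ be the $k$-subalgebra generated by all slopes $\lambda_{(P)+(Q)+(R)}$ with $P,Q,R\in E[\ell]\setminus\{O\}$ and $P\oplus Q\oplus R=O$. Then $a$, $b$, and $x_P,y_P$ for all $P\in E[\ell]\setminus\{O\}$ belong to $R'$. In particular $R_\ell=R'$, so $R_\ell$ is generated as a $k$-algebra by these slopes.
   Context: Let $k$ be a field in which $6\ell$ is invertible and which contains the $\ell$-th roots of unity. Let $K=k(a,b)$ with $a,b$ independent indeterminates, and let $E/K$ be the elliptic curve $y^2=x^3+ax+b$ with identity $O$ (the point at infinity); $\oplus,\ominus,[m]$ denote the group operations. Let $E[\ell]$ be the $\ell$-torsion in $E(\overline{K})$, and for $P\ne O$ write $P=(x_P,y_P)$; let $K_\ell=K(\{x_P,y_P: P\in E[\ell]\setminus\{O\}\})$. For $P,Q,R\in E[\ell]\setminus\{O\}$ with $P\oplus Q\oplus R=O$, the slope $\lambda_{(P)+(Q)+(R)}$ of the line through them is $(y_P-y_Q)/(x_P-x_Q)$ if $P\ne Q$ and $(3x_P^2+a)/(2y_P)$ if $P=Q$. Let $R_\ell=k[a,b,\{x_P,y_P\},\{\lambda_{(P)+(Q)+(R)}\}]\subseteq K_\ell$, the $k$-algebra generated by $a$, $b$, all $x_P,y_P$ ($P\in E[\ell]\setminus\{O\}$) and all such slopes. *)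

theory Defs
  imports
    "HOL-Algebra.Algebraic_Closure_Type"
    "HOL-Computational_Algebra.Computational_Algebra"
begin

text \<open>The algebraic closure of \<open>K = k(a, b)\<close>, with \<open>K\<close> realised as \<open>Frac (k[a][b])\<close>:
  the inner polynomial variable is \<open>a\<close>, the outer one is \<open>b\<close>.\<close>

type_synonym 'k Kbar = "'k poly poly fract alg_closure"

definition const_k :: "'k::field \<Rightarrow> 'k Kbar" where
  "const_k c = to_ac (to_fract [:[:c:]:])"

definition indet_a :: "'k::field Kbar" where
  "indet_a = to_ac (to_fract [:[:0, 1:]:])"

definition indet_b :: "'k::field Kbar" where
  "indet_b = to_ac (to_fract [:0, 1:])"

datatype 'f ec_point = Infinity | Affine (xc: 'f) (yc: 'f)

definition on_curve :: "'f::field \<Rightarrow> 'f \<Rightarrow> 'f ec_point \<Rightarrow> bool" where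
  "on_curve a b P \<longleftrightarrow>
     (case P of Infinity \<Rightarrow> True | Affine x y \<Rightarrow> y ^ 2 = x ^ 3 + a * x + b)"

text \<open>Only meaningful for affine points \<open>P\<close>, \<open>Q\<close> of the curve that are not inverse to each other.
  The third point of intersection \<open>R\<close> of the line with the curve is determined by \<open>P\<close> and \<open>Q\<close>
  and does not enter the formula.\<close>

definition line_slope :: "'f::field \<Rightarrow> 'f ec_point \<Rightarrow> 'f ec_point \<Rightarrow> 'f" where
  "line_slope a P Q =
     (if P \<noteq> Q then (yc P - yc Q) / (xc P - xc Q) else (3 * xc P ^ 2 + a) / (2 * yc P))"

text \<open>The chord-and-tangent law; the coefficient \<open>b\<close> does not enter the formulas.\<close>

fun ec_add :: "'f::field \<Rightarrow> 'f ec_point \<Rightarrow> 'f ec_point \<Rightarrow> 'f ec_point" where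
  "ec_add a Infinity Q = Q"
| "ec_add a P Infinity = P"
| "ec_add a (Affine x1 y1) (Affine x2 y2) =
     (if x1 = x2 \<and> y1 = - y2 then Infinity
      else let m = line_slope a (Affine x1 y1) (Affine x2 y2);
               x3 = m ^ 2 - x1 - x2
           in Affine x3 (m * (x1 - x3) - y1))"

definition ec_mult :: "'f::field \<Rightarrow> nat \<Rightarrow> 'f ec_point \<Rightarrow> 'f ec_point" where
  "ec_mult a n P = (ec_add a P ^^ n) Infinity"

definition nonzero_torsion :: "nat \<Rightarrow> 'k::field Kbar ec_point set" where
  "nonzero_torsion l =
     {P. on_curve indet_a indet_b P \<and> ec_mult indet_a l P = Infinity} - {Infinity}"

definition torsion_slopes :: "nat \<Rightarrow> 'k::field Kbar set" where
  "torsion_slopes l =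
     {line_slope indet_a P Q | P Q R.
        P \<in> nonzero_torsion l \<and> Q \<in> nonzero_torsion l \<and> R \<in> nonzero_torsion l \<and>
        ec_add indet_a (ec_add indet_a P Q) R = Infinity}"

text \<open>Closure under negation follows, since \<open>-1\<close> lies in \<open>k\<close>.\<close>

definition k_subalgebra :: "'k::field Kbar set \<Rightarrow> bool" where
  "k_subalgebra S \<longleftrightarrow>
     range const_k \<subseteq> S \<and> (\<forall>u\<in>S. \<forall>v\<in>S. u + v \<in> S \<and> u * v \<in> S)"

lemma k_subalgebra_hull: "k_subalgebra (k_subalgebra hull S)"
  by (rule hull_in) (fastforce simp: k_subalgebra_def)

definition R_alg :: "nat \<Rightarrow> 'k::field Kbar set" where
  "R_alg l = k_subalgebra hull
     ({indet_a, indet_b} \<union> xc ` nonzero_torsion l \<union> yc ` nonzero_torsion l \<union> torsion_slopes l)"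

definition slope_alg :: "nat \<Rightarrow> 'k::field Kbar set" where
  "slope_alg l = k_subalgebra hull (torsion_slopes l)"

end

theory Submission
  imports Defs
begin

text \<open>
  Let \<open>S\<close> be the algebra generated by the slopes. The square of the slope of the line through
  \<open>P\<close> and \<open>Q\<close> is \<open>x\<^sub>P + x\<^sub>Q + x\<^sub>P\<^sub>+\<^sub>Q\<close>. Comparing the pairs \<open>(P, Q)\<close> and \<open>(P, -Q)\<close> shows that
  \<open>x\<^sub>A - x\<^sub>B \<in> S\<close> whenever \<open>A - B \<in> 2 E[l]\<close>. Hence it suffices to find one nonzero \<open>T \<in> 2 E[l]\<close> with
  \<open>x\<^sub>T \<in> S\<close>: for every other \<open>P\<close> the relation for \<open>(P, T)\<close> then gives \<open>2 x\<^sub>P \<in> S\<close>.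
  If \<open>T\<close> has odd order, the relation for \<open>(T, T)\<close> gives \<open>3 x\<^sub>T \<in> S\<close>; if \<open>4\<close> divides \<open>l\<close>, the same follows
  for a point \<open>T\<close> of order two from the three points of order two, all of which lie in \<open>2 E[l]\<close>.
  The \<open>y\<close>-coordinates and \<open>a\<close> are obtained from the slopes of \<open>(P, Q)\<close> and \<open>(P, -Q)\<close>, where
  \<open>Q\<close> is different from \<open>P\<close> and \<open>-P\<close>. The existence of the required torsion points follows from
  the fact that multiplication by \<open>n\<close> acts on the \<open>x\<close>-coordinate by a fraction whose
  denominator has leading term \<open>n\<^sup>2 x ^ (n\<^sup>2 - 1)\<close>.
\<close>

section \<open>The group law\<close>

definition ec_neg :: "'f::field ec_point \<Rightarrow> 'f ec_point" where
  "ec_neg P = (case P of Infinity \<Rightarrow> Infinity | Affine x y \<Rightarrow> Affine x (- y))"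

lemma ec_neg_simps [simp]:
  "ec_neg Infinity = Infinity"
  "ec_neg (Affine x y) = Affine x (- y)"
  by (simp_all add: ec_neg_def)

lemma ec_neg_neg [simp]: "ec_neg (ec_neg P) = P"
  by (cases P) auto

lemma xc_ec_neg [simp]: "P \<noteq> Infinity \<Longrightarrow> xc (ec_neg P) = xc P"
  and yc_ec_neg [simp]: "P \<noteq> Infinity \<Longrightarrow> yc (ec_neg P) = - yc P"
  by (cases P; simp)+

lemma ec_neg_eq_Infinity_iff [simp]: "ec_neg P = Infinity \<longleftrightarrow> P = Infinity"
  by (cases P) auto

lemma ec_add_Infinity_right [simp]: "ec_add a P Infinity = P"
  by (cases P) auto

lemma ec_add_eq_Infinity_iff: "ec_add a P Q = Infinity \<longleftrightarrow> P = ec_neg Q"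
  by (cases P; cases Q) (auto simp: Let_def)

lemma ec_add_ec_neg [simp]:
  "ec_add a P (ec_neg P) = Infinity" "ec_add a (ec_neg P) P = Infinity"
  by (simp_all add: ec_add_eq_Infinity_iff)

lemma ec_neg_eq_iff: "ec_neg P = Q \<longleftrightarrow> P = ec_neg Q"
  by (cases P; cases Q) auto

lemma on_curve_Infinity [simp]: "on_curve a b Infinity"
  by (simp add: on_curve_def)

lemma on_curve_Affine: "on_curve a b (Affine x y) \<longleftrightarrow> y ^ 2 = x ^ 3 + a * x + b"
  by (simp add: on_curve_def)

lemma on_curve_ec_neg [simp]: "on_curve a b (ec_neg P) \<longleftrightarrow> on_curve a b P"
  by (cases P) (auto simp: on_curve_Affine)

text \<open>The first assumption is nonsingularity: the discriminant of the curve is -16 times this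
  expression. Characteristic 3 is not excluded at this stage.\<close>

locale elliptic_curve =
  fixes a b :: "'f::field"
  assumes disc: "4 * a ^ 3 + 27 * b ^ 2 \<noteq> 0"
    and two: "(2::'f) \<noteq> 0"
begin

abbreviation add (infixl "\<boxplus>" 65) where "P \<boxplus> Q \<equiv> ec_add a P Q"
abbreviation "curve \<equiv> on_curve a b"

text \<open>The hypotheses make \<open>x\<close> a multiple root of the cubic. They determine
  \<open>a\<close> and \<open>b\<close> in terms of \<open>x\<close>, and the discriminant then
  cancels identically.\<close>

lemma smooth:
  assumes "x ^ 3 + a * x + b = 0" "3 * x ^ 2 + a = 0"
  shows False
proof -
  have "a = - 3 * x ^ 2" and "b = 2 * x ^ 3" using assms by (Groebner_Basis.algebra, Groebner_Basis.algebra)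
  then have "4 * a ^ 3 + 27 * b ^ 2 = 0" by Groebner_Basis.algebra
  with disc show False by simp
qed

text \<open>The second equation is the difference of the two curve equations divided by
  \<open>x1 - x2\<close>. It survives when the points coincide, where it is the tangent
  formula.\<close>

lemma line_slope_exists:
  assumes "curve (Affine x1 y1)" "curve (Affine x2 y2)" "\<not> (x1 = x2 \<and> y1 = - y2)"
  defines "m \<equiv> line_slope a (Affine x1 y1) (Affine x2 y2)"
  shows "m * (x1 - x2) = y1 - y2" "m * (y1 + y2) = x1 ^ 2 + x1 * x2 + x2 ^ 2 + a"
proof -
  have c: "y1 ^ 2 = x1 ^ 3 + a * x1 + b" "y2 ^ 2 = x2 ^ 3 + a * x2 + b"
    using assms by (auto simp: on_curve_Affine)
  have "m * (x1 - x2) = y1 - y2 \<and> m * (y1 + y2) = x1 ^ 2 + x1 * x2 + x2 ^ 2 + a"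
  proof (cases "x1 = x2")
    case True
    then have [simp]: "y1 = y2" using c assms(3) by (metis power2_eq_iff)
    have "2 * y2 \<noteq> 0" using assms(3) True two by (metis \<open>y1 = y2\<close> add_eq_0_iff2 mult_2)
    then have "m * (2 * y2) = 3 * x2 ^ 2 + a"
      using True by (simp add: m_def line_slope_def)
    then show ?thesis using True \<open>y1 = y2\<close> by Groebner_Basis.algebra
  next
    case False
    then have "m * (x1 - x2) = y1 - y2" by (simp add: m_def line_slope_def)
    moreover have "(x1 - x2) * (m * (y1 + y2)) = (x1 - x2) * (x1 ^ 2 + x1 * x2 + x2 ^ 2 + a)"
      using c calculation by Groebner_Basis.algebra
    ultimately show ?thesis using False by simp
  qed
  then show "m * (x1 - x2) = y1 - y2" "m * (y1 + y2) = x1 ^ 2 + x1 * x2 + x2 ^ 2 + a" by auto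
qed

text \<open>These two linear equations treat chords and tangents uniformly: at least one of them
  determines the slope as soon as the two points are not inverse to each other.\<close>

lemma line_slope_unique:
  assumes "curve (Affine x1 y1)" "curve (Affine x2 y2)" "\<not> (x1 = x2 \<and> y1 = - y2)"
    and "m * (x1 - x2) = y1 - y2" "m * (y1 + y2) = x1 ^ 2 + x1 * x2 + x2 ^ 2 + a"
  shows "line_slope a (Affine x1 y1) (Affine x2 y2) = m"
proof (cases "x1 = x2")
  case True
  then show ?thesis
    using line_slope_exists(2)[OF assms(1-3)] assms(3,5)
    by (metis add_eq_0_iff2 mult_right_cancel)
next
  case False
  then show ?thesis
    using line_slope_exists(1)[OF assms(1-3)] assms(4)
    by (metis mult_right_cancel right_minus_eq)
qed

lemma ec_add_obtain_slope:
  assumes "curve (Affine x1 y1)" "curve (Affine x2 y2)"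
    and "Affine x1 y1 \<boxplus> Affine x2 y2 \<noteq> Infinity"
  obtains m where "m = line_slope a (Affine x1 y1) (Affine x2 y2)"
    and "m * (x1 - x2) = y1 - y2" "m * (y1 + y2) = x1 ^ 2 + x1 * x2 + x2 ^ 2 + a"
    and "Affine x1 y1 \<boxplus> Affine x2 y2 =
      Affine (m ^ 2 - x1 - x2) (m * (x1 - (m ^ 2 - x1 - x2)) - y1)"
  using line_slope_exists[OF assms(1,2)] assms(3) by (auto simp: Let_def split: if_splits)

lemma ec_addI:
  assumes "curve (Affine x1 y1)" "curve (Affine x2 y2)"
    and "Affine x1 y1 \<boxplus> Affine x2 y2 \<noteq> Infinity"
    and "m * (x1 - x2) = y1 - y2" "m * (y1 + y2) = x1 ^ 2 + x1 * x2 + x2 ^ 2 + a"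
  shows "Affine x1 y1 \<boxplus> Affine x2 y2 =
      Affine (m ^ 2 - x1 - x2) (m * (x1 - (m ^ 2 - x1 - x2)) - y1)"
  using line_slope_unique[OF assms(1,2) _ assms(4,5)] assms(3)
  by (auto simp: Let_def split: if_splits)

section \<open>Closure, commutativity, negation and cancellation\<close>

lemma curve_add:
  assumes "curve P" "curve Q"
  shows "curve (P \<boxplus> Q)"
proof (cases "P = Infinity \<or> Q = Infinity \<or> P \<boxplus> Q = Infinity")
  case False
  then obtain x1 y1 x2 y2 where [simp]: "P = Affine x1 y1" "Q = Affine x2 y2"
    by (cases P; cases Q) auto
  obtain m where m: "m * (x1 - x2) = y1 - y2" "m * (y1 + y2) = x1 ^ 2 + x1 * x2 + x2 ^ 2 + a"
    "P \<boxplus> Q = Affine (m ^ 2 - x1 - x2) (m * (x1 - (m ^ 2 - x1 - x2)) - y1)"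
    using ec_add_obtain_slope[of x1 y1 x2 y2] assms False by auto
  \<comment> \<open>The relations are linear in \<open>b\<close>, \<open>a\<close> and
    \<open>y2\<close>. Eliminating these leaves a polynomial identity in the free quantities
    \<open>x1\<close>, \<open>x2\<close>, \<open>y1\<close>, \<open>m\<close>.\<close>
  have b: "b = y1 ^ 2 - x1 ^ 3 - a * x1" using assms by (simp add: on_curve_Affine)
  have a: "a = m * (y1 + y2) - (x1 ^ 2 + x1 * x2 + x2 ^ 2)" using m(2) by simp
  have y2: "y2 = y1 - m * (x1 - x2)" using m(1) by simp
  show ?thesis
    unfolding m(3) on_curve_Affine unfolding b a y2 by Groebner_Basis.algebra
qed (use assms in auto)

lemma add_commute:
  assumes "curve P" "curve Q"
  shows "P \<boxplus> Q = Q \<boxplus> P"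
proof (cases "P = Infinity \<or> Q = Infinity \<or> P \<boxplus> Q = Infinity")
  case True
  then show ?thesis
    using ec_add_eq_Infinity_iff[of a P Q] ec_add_eq_Infinity_iff[of a Q P] by auto
next
  case False
  then obtain x1 y1 x2 y2 where [simp]: "P = Affine x1 y1" "Q = Affine x2 y2"
    by (cases P; cases Q) auto
  obtain m where m: "m * (x1 - x2) = y1 - y2" "m * (y1 + y2) = x1 ^ 2 + x1 * x2 + x2 ^ 2 + a"
    "P \<boxplus> Q = Affine (m ^ 2 - x1 - x2) (m * (x1 - (m ^ 2 - x1 - x2)) - y1)"
    using ec_add_obtain_slope[of x1 y1 x2 y2] assms False by auto
  have "Q \<boxplus> P \<noteq> Infinity"
    using False ec_add_eq_Infinity_iff[of a P Q] ec_add_eq_Infinity_iff[of a Q P] by auto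
  \<comment> \<open>Both equations for the slope are symmetric in the two points, so the same
    \<open>m\<close> serves.\<close>
  then have "Q \<boxplus> P = Affine (m ^ 2 - x2 - x1) (m * (x2 - (m ^ 2 - x2 - x1)) - y2)"
    using ec_addI[of x2 y2 x1 y1 m] assms m(1,2) by (simp add: algebra_simps)
  moreover have "m * (x2 - (m ^ 2 - x2 - x1)) - y2 = m * (x1 - (m ^ 2 - x1 - x2)) - y1"
    using m(1,2) by Groebner_Basis.algebra
  ultimately show ?thesis using m(3) by (simp add: algebra_simps)
qed

lemma neg_add:
  assumes "curve P" "curve Q"
  shows "ec_neg (P \<boxplus> Q) = ec_neg P \<boxplus> ec_neg Q"
proof (cases "P = Infinity \<or> Q = Infinity \<or> P \<boxplus> Q = Infinity")
  case True
  then show ?thesis by (auto simp: ec_add_eq_Infinity_iff)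
next
  case False
  then obtain x1 y1 x2 y2 where [simp]: "P = Affine x1 y1" "Q = Affine x2 y2"
    by (cases P; cases Q) auto
  obtain m where m: "m * (x1 - x2) = y1 - y2" "m * (y1 + y2) = x1 ^ 2 + x1 * x2 + x2 ^ 2 + a"
    "P \<boxplus> Q = Affine (m ^ 2 - x1 - x2) (m * (x1 - (m ^ 2 - x1 - x2)) - y1)"
    using ec_add_obtain_slope[of x1 y1 x2 y2] assms False by auto
  have "ec_neg P \<boxplus> ec_neg Q \<noteq> Infinity"
    using False unfolding ec_add_eq_Infinity_iff ec_neg_eq_iff by simp
  moreover have "- m * (x1 - x2) = - y1 - - y2" using m(1) by Groebner_Basis.algebra
  moreover have "- m * (- y1 + - y2) = x1 ^ 2 + x1 * x2 + x2 ^ 2 + a" using m(2) by Groebner_Basis.algebra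
  ultimately have "ec_neg P \<boxplus> ec_neg Q =
      Affine ((- m) ^ 2 - x1 - x2) (- m * (x1 - ((- m) ^ 2 - x1 - x2)) - - y1)"
    using ec_addI[of x1 "- y1" x2 "- y2" "- m"] assms by (simp add: on_curve_Affine)
  then show ?thesis unfolding m(3) by simp
qed

text \<open>The line through \<open>P \<boxplus> Q\<close> and \<open>ec_neg Q\<close> is the
  reflection of the line through \<open>P\<close> and \<open>Q\<close>. Hence its slope is
  \<open>- m\<close> and its third intersection point is \<open>ec_neg P\<close>.\<close>

lemma add_neg_cancel:
  assumes "curve P" "curve Q"
  shows "P \<boxplus> Q \<boxplus> ec_neg Q = P"
proof (cases "P = Infinity \<or> Q = Infinity \<or> P \<boxplus> Q = Infinity")
  case True
  then show ?thesis by (auto simp: ec_add_eq_Infinity_iff ec_neg_eq_iff)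
next
  case False
  then obtain x1 y1 x2 y2 where PQ [simp]: "P = Affine x1 y1" "Q = Affine x2 y2"
    by (cases P; cases Q) auto
  obtain m where m: "m * (x1 - x2) = y1 - y2" "m * (y1 + y2) = x1 ^ 2 + x1 * x2 + x2 ^ 2 + a"
    "P \<boxplus> Q = Affine (m ^ 2 - x1 - x2) (m * (x1 - (m ^ 2 - x1 - x2)) - y1)"
    using ec_add_obtain_slope[of x1 y1 x2 y2] assms False by auto
  have c: "y1 ^ 2 = x1 ^ 3 + a * x1 + b" "y2 ^ 2 = x2 ^ 3 + a * x2 + b"
    using assms by (auto simp: on_curve_Affine)
  define x3 y3 where xy3: "x3 = m ^ 2 - x1 - x2" "y3 = m * (x1 - x3) - y1"
  have PQ3: "P \<boxplus> Q = Affine x3 y3" unfolding xy3 by (rule m(3))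
  have a_eq: "a = m * (y1 + y2) - (x1 ^ 2 + x1 * x2 + x2 ^ 2)" using m(2) by simp
  have y1: "y1 = y2 + m * (x1 - x2)" using m(1) by simp
  have y3: "y3 = m * (x2 - x3) - y2" unfolding xy3(2) y1 by Groebner_Basis.algebra
  \<comment> \<open>Otherwise \<open>P \<boxplus> Q = Q\<close> with \<open>P\<close> affine, which
    would make \<open>Q\<close> a singular point of the curve.\<close>
  have "P \<boxplus> Q \<boxplus> ec_neg Q \<noteq> Infinity"
  proof
    assume "P \<boxplus> Q \<boxplus> ec_neg Q = Infinity"
    then have eq: "x3 = x2" "y3 = y2" using PQ3 by (auto simp: ec_add_eq_Infinity_iff)
    have "2 * y2 = 0" using eq y3 by simp
    with two have "y2 = 0" by simp
    moreover have "3 * x2 ^ 2 + a = 0"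
    proof -
      have "x2 = m ^ 2 - x1 - x2" using eq(1) xy3(1) by metis
      then have "x1 = m ^ 2 - 2 * x2" by Groebner_Basis.algebra
      then show ?thesis unfolding a_eq y1 \<open>y2 = 0\<close> by Groebner_Basis.algebra
    qed
    ultimately show False using smooth[of x2] c by simp
  qed
  moreover have "- m * (x3 - x2) = y3 - - y2" unfolding y3 by Groebner_Basis.algebra
  moreover have "- m * (y3 + - y2) = x3 ^ 2 + x3 * x2 + x2 ^ 2 + a"
    unfolding y3 xy3(1) a_eq y1 by Groebner_Basis.algebra
  moreover have "curve (Affine x3 y3)" using curve_add[OF assms] PQ3 by simp
  ultimately have "P \<boxplus> Q \<boxplus> ec_neg Q =
      Affine ((- m) ^ 2 - x3 - x2) (- m * (x3 - ((- m) ^ 2 - x3 - x2)) - y3)"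
    using ec_addI[of x3 y3 x2 "- y2" "- m"] c PQ3 by (simp add: on_curve_Affine)
  moreover have "(- m) ^ 2 - x3 - x2 = x1" using xy3 by Groebner_Basis.algebra
  ultimately show ?thesis using xy3 by (simp add: algebra_simps)
qed

text \<open>Write \<open>m\<close> and \<open>n\<close> for the slopes of \<open>(A, B)\<close> and \<open>(B, C)\<close>. The slopes of \<open>(A + B, C)\<close> and
  \<open>(A, B + C)\<close> are then \<open>s - m\<close> and \<open>s - n\<close> for the common value \<open>s = (x\<^sub>A - x\<^sub>C) / (m - n)\<close>.\<close>

lemma slope_exchange:
  fixes x1 x2 x3 y1 y2 y3 m n :: 'f
  assumes m: "m * (x1 - x2) = y1 - y2" "m * (y1 + y2) = x1 ^ 2 + x1 * x2 + x2 ^ 2 + a"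
    and n: "n * (x2 - x3) = y2 - y3" "n * (y2 + y3) = x2 ^ 2 + x2 * x3 + x3 ^ 2 + a"
    and xy: "x = m ^ 2 - x1 - x2" "y = m * (x1 - x) - y1"
  shows "(x1 - x3) * (x - x3) = (m - n) * (y - y3 + m * (x - x3))"
proof -
  have y1: "y1 = y2 + m * (x1 - x2)" and y3: "y3 = y2 - n * (x2 - x3)" using m n by simp_all
  have y: "y = m * (x2 - x) - y2" unfolding xy(2) y1 by Groebner_Basis.algebra
  have "n * (y2 + y3) - (x2 ^ 2 + x2 * x3 + x3 ^ 2) = m * (y1 + y2) - (x1 ^ 2 + x1 * x2 + x2 ^ 2)"
    using m(2) n(2) by simp
  then show ?thesis
    unfolding y xy(1) y1 y3 by Groebner_Basis.algebra
qed

lemma second_slope: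
  fixes x1 x2 x3 y1 y2 y3 m n s :: 'f
  assumes m: "m * (x1 - x2) = y1 - y2" "m * (y1 + y2) = x1 ^ 2 + x1 * x2 + x2 ^ 2 + a"
    and n: "n * (x2 - x3) = y2 - y3" "n * (y2 + y3) = x2 ^ 2 + x2 * x3 + x3 ^ 2 + a"
    and s: "s * (m - n) = x1 - x3" "m \<noteq> n"
    and xy: "x = m ^ 2 - x1 - x2" "y = m * (x1 - x) - y1"
    and c: "y ^ 2 = x ^ 3 + a * x + b" "y3 ^ 2 = x3 ^ 3 + a * x3 + b"
  shows "(s - m) * (x - x3) = y - y3"
    and "(s - m) * (y + y3) = x ^ 2 + x * x3 + x3 ^ 2 + a"
proof -
  have y1: "y1 = y2 + m * (x1 - x2)" and y3: "y3 = y2 - n * (x2 - x3)" using m n by simp_all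
  have y: "y = m * (x2 - x) - y2" unfolding xy(2) y1 by Groebner_Basis.algebra
  have "(m - n) * ((s - m) * (x - x3)) = (m - n) * (y - y3)"
    using slope_exchange[OF m n xy] s(1) by Groebner_Basis.algebra
  then show 1: "(s - m) * (x - x3) = y - y3" using s(2) by simp
  show "(s - m) * (y + y3) = x ^ 2 + x * x3 + x3 ^ 2 + a"
  proof (cases "x = x3")
    case False
    have "(x - x3) * ((s - m) * (y + y3)) = (x - x3) * (x ^ 2 + x * x3 + x3 ^ 2 + a)"
      using 1 c by Groebner_Basis.algebra
    with False show ?thesis by simp
  next
    \<comment> \<open>Division by \<open>x - x3\<close> is impossible here. The two points coincide,
      so the tangent equation has to be verified; writing \<open>2 * y3\<close> as a multiple of
      \<open>m - n\<close> lets the equation for \<open>s\<close> apply.\<close>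
    case True
    with 1 have "y = y3" by simp
    have sum: "y2 + y3 = m * (x2 - x3)" using y True \<open>y = y3\<close> by simp
    then have y3': "2 * y3 = (m - n) * (x2 - x3)" using y3 by Groebner_Basis.algebra
    have a_eq: "a = n * (m * (x2 - x3)) - (x2 ^ 2 + x2 * x3 + x3 ^ 2)" using n(2) sum by simp
    have x1: "x1 = m ^ 2 - x2 - x3" using xy(1) True by simp
    have "(s - m) * (2 * y3) = (s * (m - n) - m * (m - n)) * (x2 - x3)"
      unfolding y3' by Groebner_Basis.algebra
    also have "\<dots> = 3 * x3 ^ 2 + a"
      unfolding s(1) x1 a_eq by Groebner_Basis.algebra
    finally show ?thesis using True \<open>y = y3\<close> by Groebner_Basis.algebra
  qed
qed

text \<open>If some partial sum is \<open>Infinity\<close>, cancellation suffices. The case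
  \<open>A = C\<close> follows from commutativity and is split off because the slopes
  \<open>m\<close> and \<open>n\<close> then agree, leaving \<open>s\<close> undefined. Otherwise
  both sides are computed from \<open>s\<close>.\<close>

lemma add_assoc:
  assumes "curve A" "curve B" "curve C"
  shows "A \<boxplus> B \<boxplus> C = A \<boxplus> (B \<boxplus> C)"
proof -
  have canc: "ec_neg B' \<boxplus> (B' \<boxplus> A') = A'" "B' \<boxplus> (ec_neg B' \<boxplus> A') = A'"
    if "curve A'" "curve B'" for A' B'
    using add_neg_cancel[OF that] add_neg_cancel[of A' "ec_neg B'"] that
    by (simp_all add: add_commute curve_add)
  consider "A = Infinity" | "B = Infinity" | "C = Infinity" | "A \<boxplus> B = Infinity"
    | "B \<boxplus> C = Infinity" | "A \<boxplus> B \<boxplus> C = Infinity" | "A \<boxplus> (B \<boxplus> C) = Infinity" | "A = C"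
    | (nondegenerate) "A \<noteq> Infinity" "B \<noteq> Infinity" "C \<noteq> Infinity"
      "A \<boxplus> B \<noteq> Infinity" "B \<boxplus> C \<noteq> Infinity" "A \<boxplus> B \<boxplus> C \<noteq> Infinity"
      "A \<boxplus> (B \<boxplus> C) \<noteq> Infinity" "A \<noteq> C"
    by argo
  then show ?thesis
  proof cases
    case 4
    then show ?thesis using canc[of C B] assms by (simp add: ec_add_eq_Infinity_iff)
  next
    case 5
    then show ?thesis using add_neg_cancel[of A C] add_neg_cancel[of A "ec_neg C"] assms
      by (simp add: ec_add_eq_Infinity_iff)
  next
    case 6
    then have "C = ec_neg (A \<boxplus> B)" by (simp add: ec_add_eq_Infinity_iff)
    then have "B \<boxplus> C = ec_neg A"
      using canc(2)[of "ec_neg A" B] assms by (simp add: neg_add add_commute[of "ec_neg A"])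
    then show ?thesis using 6 by (simp add: ec_add_eq_Infinity_iff)
  next
    case 7
    then have "A = ec_neg (B \<boxplus> C)" by (simp add: ec_add_eq_Infinity_iff)
    then have "A \<boxplus> B = ec_neg C"
      using add_neg_cancel[of "ec_neg C" "ec_neg B"] assms
      by (simp add: neg_add add_commute[of "ec_neg B"])
    then show ?thesis using 7 by (simp add: ec_add_eq_Infinity_iff)
  next
    case 8
    then show ?thesis using assms add_commute curve_add by metis
  next
    case nondegenerate
    obtain x1 y1 x2 y2 x3 y3
      where ABC: "A = Affine x1 y1" "B = Affine x2 y2" "C = Affine x3 y3"
      using nondegenerate(1-3) by (metis ec_point.exhaust)
    obtain m where m: "m * (x1 - x2) = y1 - y2" "m * (y1 + y2) = x1 ^ 2 + x1 * x2 + x2 ^ 2 + a"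
      "A \<boxplus> B = Affine (m ^ 2 - x1 - x2) (m * (x1 - (m ^ 2 - x1 - x2)) - y1)"
      using ec_add_obtain_slope[of x1 y1 x2 y2] assms nondegenerate ABC by auto
    obtain n where n: "n * (x2 - x3) = y2 - y3" "n * (y2 + y3) = x2 ^ 2 + x2 * x3 + x3 ^ 2 + a"
      "B \<boxplus> C = Affine (n ^ 2 - x2 - x3) (n * (x2 - (n ^ 2 - x2 - x3)) - y2)"
      using ec_add_obtain_slope[of x2 y2 x3 y3] assms nondegenerate ABC by auto
    define x y where xy: "x = m ^ 2 - x1 - x2" "y = m * (x1 - x) - y1"
    define x' y' where xy': "x' = n ^ 2 - x3 - x2" "y' = n * (x3 - x') - y3"
    have AB: "A \<boxplus> B = Affine x y" unfolding xy by (rule m(3))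
    have "n ^ 2 - x2 - x3 = x'" unfolding xy' by simp
    moreover have "n * (x2 - x') - y2 = y'" unfolding xy'(2) using n(1) by Groebner_Basis.algebra
    ultimately have BC: "B \<boxplus> C = Affine x' y'" using n(3) by simp
    have c: "y1 ^ 2 = x1 ^ 3 + a * x1 + b" "y3 ^ 2 = x3 ^ 3 + a * x3 + b"
      "y ^ 2 = x ^ 3 + a * x + b" "y' ^ 2 = x' ^ 3 + a * x' + b"
      using assms curve_add[of A B] curve_add[of B C] AB BC ABC by (simp_all add: on_curve_Affine)
    \<comment> \<open>Equal slopes would force \<open>A = C\<close>, or
      \<open>A \<boxplus> B = ec_neg C\<close>; both are excluded.\<close>
    have "m \<noteq> n"
    proof
      assume "m = n"
      then have "(x1 - x3) * (x - x3) = 0"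
        using slope_exchange[OF m(1,2) n(1,2) xy] by simp
      then consider "x1 = x3" | "x = x3" by auto
      then show False
      proof cases
        case 1
        then have "n * (x3 - x2) = y1 - y2" using \<open>m = n\<close> m(1) by metis
        then have "y1 = y3" using n(1) by Groebner_Basis.algebra
        with 1 nondegenerate ABC show False by simp
      next
        case 2
        then have "y = n * (x1 - x3) - y1" "n * (x1 - x2) = y1 - y2"
          using \<open>m = n\<close> m(1) xy(2) by metis+
        then have "y = - y3" using n(1) by Groebner_Basis.algebra
        with 2 have "A \<boxplus> B \<boxplus> C = Infinity" unfolding AB unfolding ABC by simp
        with nondegenerate(6) show False ..
      qed
    qed
    define s where "s = (x1 - x3) / (m - n)"
    have s: "s * (m - n) = x1 - x3" using \<open>m \<noteq> n\<close> by (simp add: s_def)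
    note S = second_slope[OF m(1,2) n(1,2) s \<open>m \<noteq> n\<close> xy c(3,2)]
    have L: "A \<boxplus> B \<boxplus> C =
        Affine ((s - m) ^ 2 - x - x3) ((s - m) * (x - ((s - m) ^ 2 - x - x3)) - y)"
      using S nondegenerate(6)
      unfolding AB unfolding ABC by (intro ec_addI) (simp_all add: on_curve_Affine c)
    \<comment> \<open>The other bracketing is treated as the first one for the reversed triple
      \<open>C\<close>, \<open>B\<close>, \<open>A\<close>; this exchanges \<open>m\<close> and
      \<open>n\<close> and keeps \<open>s\<close>.\<close>
    have n': "n * (x3 - x2) = y3 - y2" "n * (y3 + y2) = x3 ^ 2 + x3 * x2 + x2 ^ 2 + a"
      using n(1,2) by (Groebner_Basis.algebra, Groebner_Basis.algebra)
    have m': "m * (x2 - x1) = y2 - y1" "m * (y2 + y1) = x2 ^ 2 + x2 * x1 + x1 ^ 2 + a"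
      using m(1,2) by (Groebner_Basis.algebra, Groebner_Basis.algebra)
    have s': "s * (n - m) = x3 - x1" using s by Groebner_Basis.algebra
    note S' = second_slope[OF n' m' s' \<open>m \<noteq> n\<close>[symmetric] xy' c(4,1)]
    have "(s - n) * (x1 - x') = y1 - y'" using S'(1) by Groebner_Basis.algebra
    moreover have "(s - n) * (y1 + y') = x1 ^ 2 + x1 * x' + x' ^ 2 + a" using S'(2) by Groebner_Basis.algebra
    ultimately have R: "A \<boxplus> (B \<boxplus> C) =
        Affine ((s - n) ^ 2 - x1 - x') ((s - n) * (x1 - ((s - n) ^ 2 - x1 - x')) - y1)"
      using nondegenerate(7)
      unfolding BC unfolding ABC by (intro ec_addI) (simp_all add: on_curve_Affine c)
    have eqx: "(s - m) ^ 2 - x - x3 = (s - n) ^ 2 - x1 - x'" unfolding xy xy' using s by Groebner_Basis.algebra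
    define x4 where "x4 = (s - m) ^ 2 - x - x3"
    have x4: "x4 = x2 + s ^ 2 - s * (m + n)" unfolding x4_def xy(1) using s by Groebner_Basis.algebra
    have "(s - m) * (x - x4) - y = (s - m) * (x3 - x4) - y3" using S(1) by Groebner_Basis.algebra
    also have "\<dots> = (s - n) * (x1 - x4) - y1" unfolding x4 using s m(1) n(1) by Groebner_Basis.algebra
    finally have "(s - m) * (x - x4) - y = (s - n) * (x1 - x4) - y1" .
    then show ?thesis unfolding L R using eqx x4_def by simp
  qed (simp_all)
qed

end

section \<open>Relations between \<open>x\<close>-coordinates in an abelian group\<close>

text \<open>The function \<open>f\<close> below will be the \<open>x\<close>-coordinate, and \<open>S\<close> the algebra generated by the slopes,
  which contains \<open>f P + f Q + f (P \<otimes> Q)\<close> as the square of a slope.\<close>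

locale x_relations = comm_group G for G :: "('p, 'q) monoid_scheme" (structure) +
  fixes f :: "'p \<Rightarrow> 'f::field" and S :: "'f set"
  assumes zero_S: "0 \<in> S"
    and diff_S: "u \<in> S \<Longrightarrow> v \<in> S \<Longrightarrow> u - v \<in> S"
    and half_S: "2 * u \<in> S \<Longrightarrow> u \<in> S"
    and third_S: "3 * u \<in> S \<Longrightarrow> u \<in> S"
    and f_inv: "P \<in> carrier G \<Longrightarrow> P \<noteq> \<one> \<Longrightarrow> f (inv P) = f P"
    and f_rel: "P \<in> carrier G \<Longrightarrow> Q \<in> carrier G \<Longrightarrow> P \<noteq> \<one> \<Longrightarrow> Q \<noteq> \<one> \<Longrightarrow> P \<otimes> Q \<noteq> \<one> \<Longrightarrow>
      f P + f Q + f (P \<otimes> Q) \<in> S"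
begin

lemma f_diff:
  assumes B: "B \<in> carrier G" "B \<noteq> \<one>" and Q: "Q \<in> carrier G" and nz: "B \<otimes> (Q \<otimes> Q) \<noteq> \<one>"
  shows "f (B \<otimes> (Q \<otimes> Q)) - f B \<in> S"
proof -
  define P where "P = B \<otimes> Q"
  have P: "P \<in> carrier G" "P \<otimes> Q = B \<otimes> (Q \<otimes> Q)" "P \<otimes> inv Q = B"
    using B Q by (simp_all add: P_def m_assoc)
  \<comment> \<open>The relation \<open>f_rel\<close> needs nontrivial \<open>P\<close> and
    \<open>Q\<close>. If one of them is trivial, \<open>B \<otimes> (Q \<otimes> Q)\<close> is
    \<open>B\<close> or its inverse, so the difference vanishes.\<close>
  consider "Q = \<one>" | "P = \<one>" | "Q \<noteq> \<one>" "P \<noteq> \<one>" by blast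
  then show ?thesis
  proof cases
    case 1
    then show ?thesis using B zero_S by simp
  next
    case 2
    then have "B = inv Q" using B Q inv_equality[of B Q] by (simp add: P_def)
    moreover from this have "B \<otimes> (Q \<otimes> Q) = Q" using Q P(2) 2 by simp
    ultimately show ?thesis using Q B f_inv[of Q] nz zero_S by simp
  next
    case 3
    have "f P + f Q + f (B \<otimes> (Q \<otimes> Q)) \<in> S"
      using f_rel[of P Q] P Q 3 nz by simp
    moreover have "f P + f Q + f B \<in> S"
      using f_rel[of P "inv Q"] f_inv[of Q] P Q 3 B by simp
    ultimately show ?thesis using diff_S by fastforce
  qed
qed

lemma f_mem:
  assumes T: "T \<in> carrier G" "T \<otimes> T \<noteq> \<one>" "f (T \<otimes> T) \<in> S"
    and P: "P \<in> carrier G" "P \<noteq> \<one>"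
  shows "f P \<in> S"
proof (cases "P \<otimes> (T \<otimes> T) = \<one>")
  case True
  then have "P = inv (T \<otimes> T)" using P T inv_equality by (metis m_closed)
  then show ?thesis using f_inv T by simp
next
  case False
  then have "f P + f (T \<otimes> T) + f (P \<otimes> (T \<otimes> T)) \<in> S" using f_rel P T by simp
  from diff_S[OF diff_S[OF this T(3)] f_diff[OF P T(1) False]]
  have "2 * f P \<in> S" by (simp add: algebra_simps)
  then show ?thesis by (rule half_S)
qed

lemma f_mem_of_odd_order:
  assumes T: "T \<in> carrier G" "T \<noteq> \<one>" "T [^] (2 * j + 1 :: nat) = \<one>"
    and P: "P \<in> carrier G" "P \<noteq> \<one>"
  shows "f P \<in> S"
proof -
  \<comment> \<open>Twice \<open>j + 1\<close> is one more than the odd exponent killing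
    \<open>T\<close>, so \<open>Q\<close> is a half of \<open>T\<close> and \<open>f_diff\<close>
    can compare \<open>T\<close> with its double.\<close>
  define Q where "Q = T [^] (j + 1)"
  have Q: "Q \<in> carrier G" using T by (simp add: Q_def)
  have "Q \<otimes> Q = T [^] ((2 * j + 1) + 1)"
    unfolding Q_def by (subst nat_pow_mult[OF T(1)]) (simp add: mult_2)
  also have "\<dots> = T" using T by simp
  finally have QQ: "Q \<otimes> Q = T" .
  have "T \<otimes> T \<noteq> \<one>"
  proof
    assume "T \<otimes> T = \<one>"
    then have "T [^] (2 * j) = \<one>" using nat_pow_pow[OF T(1), of 2 j] T by (simp add: numeral_2_eq_2)
    with T show False by simp
  qed
  then have "f (T \<otimes> T) - f T \<in> S" "f T + f T + f (T \<otimes> T) \<in> S"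
    using f_diff[of T Q] f_rel[of T T] T Q QQ by auto
  from diff_S[OF this(2,1)] have "3 * f T \<in> S" by (simp add: algebra_simps)
  then show ?thesis using f_mem[OF Q _ _ P] third_S T(2) QQ by simp
qed

text \<open>The involutions \<open>e1\<close>, \<open>e2\<close> and \<open>e1 \<otimes> e2\<close>
  differ by squares, so their values under \<open>f\<close> agree modulo \<open>S\<close>. Their sum
  lies in \<open>S\<close>, which yields three times \<open>f e1\<close>.\<close>

lemma f_mem_of_halved_involutions:
  assumes T: "T1 \<in> carrier G" "T2 \<in> carrier G"
    and e: "e1 = T1 \<otimes> T1" "e2 = T2 \<otimes> T2" "e1 \<noteq> \<one>" "e2 \<noteq> \<one>" "e1 \<noteq> e2"
      "e1 \<otimes> e1 = \<one>" "e2 \<otimes> e2 = \<one>"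
    and P: "P \<in> carrier G" "P \<noteq> \<one>"
  shows "f P \<in> S"
proof -
  have ec: "e1 \<in> carrier G" "e2 \<in> carrier G" using T e by auto
  have "e1 \<otimes> e2 \<noteq> \<one>" using e ec inv_equality by (metis m_comm)
  moreover have "e1 \<otimes> ((T1 \<otimes> T2) \<otimes> (T1 \<otimes> T2)) = e2"
  proof -
    have "(T1 \<otimes> T2) \<otimes> (T1 \<otimes> T2) = e1 \<otimes> e2" unfolding e using T by (simp add: m_ac)
    then show ?thesis using e ec by (simp add: m_assoc[symmetric])
  qed
  ultimately have "f e1 + f e2 + f (e1 \<otimes> e2) \<in> S" "f e2 - f e1 \<in> S" "f (e1 \<otimes> e2) - f e1 \<in> S"
    using f_rel[of e1 e2] f_diff[of e1 "T1 \<otimes> T2"] f_diff[of e1 T2] T e ec by auto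
  from diff_S[OF diff_S[OF this(1,2)] this(3)] have "3 * f e1 \<in> S" by (simp add: algebra_simps)
  then show ?thesis using f_mem[OF T(1) _ _ P] third_S e by simp
qed

end

section \<open>Torsion subgroups\<close>

context elliptic_curve
begin

definition curve_group :: "'f ec_point monoid" where
  "curve_group = \<lparr>carrier = Collect curve, monoid.mult = ec_add a, one = Infinity\<rparr>"

definition torsion_group :: "nat \<Rightarrow> 'f ec_point monoid" where
  "torsion_group l = curve_group\<lparr>carrier := {P. curve P \<and> ec_mult a l P = Infinity}\<rparr>"

lemma curve_group_simps [simp]:
  "carrier curve_group = Collect curve" "monoid.mult curve_group = ec_add a" "one curve_group = Infinity"
  by (simp_all add: curve_group_def)

lemma torsion_group_simps [simp]:
  "carrier (torsion_group l) = {P. curve P \<and> ec_mult a l P = Infinity}"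
  "monoid.mult (torsion_group l) = ec_add a" "one (torsion_group l) = Infinity"
  by (simp_all add: torsion_group_def)

lemma comm_group_curve_group: "comm_group curve_group"
proof (rule comm_groupI)
  fix P assume "P \<in> carrier curve_group"
  then show "\<exists>Q\<in>carrier curve_group. Q \<otimes>\<^bsub>curve_group\<^esub> P = \<one>\<^bsub>curve_group\<^esub>"
    by (intro bexI[of _ "ec_neg P"]) auto
qed (auto simp: curve_add add_assoc intro: add_commute)

sublocale EG: comm_group curve_group
  by (rule comm_group_curve_group)

lemma ec_mult_eq_pow: "curve P \<Longrightarrow> ec_mult a n P = P [^]\<^bsub>curve_group\<^esub> n"
proof (induction n)
  case (Suc n)
  then show ?case using EG.nat_pow_Suc2[of P n] by (simp add: ec_mult_def)
qed (simp add: ec_mult_def)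

lemma inv_curve_group: "curve P \<Longrightarrow> inv\<^bsub>curve_group\<^esub> P = ec_neg P"
  by (rule EG.inv_equality) auto

lemma subgroup_torsion: "subgroup {P. curve P \<and> ec_mult a l P = Infinity} curve_group"
proof (rule EG.subgroupI)
  show "{P. curve P \<and> ec_mult a l P = Infinity} \<noteq> {}"
    using EG.nat_pow_one[of l] by (auto simp: ec_mult_eq_pow intro!: exI[of _ Infinity])
next
  fix P assume "P \<in> {P. curve P \<and> ec_mult a l P = Infinity}"
  then show "inv\<^bsub>curve_group\<^esub> P \<in> {P. curve P \<and> ec_mult a l P = Infinity}"
    using EG.nat_pow_inv[of P l]
    by (auto simp: ec_mult_eq_pow inv_curve_group)
next
  fix P Q assume "P \<in> {P. curve P \<and> ec_mult a l P = Infinity}"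
    "Q \<in> {P. curve P \<and> ec_mult a l P = Infinity}"
  then show "P \<otimes>\<^bsub>curve_group\<^esub> Q \<in> {P. curve P \<and> ec_mult a l P = Infinity}"
    using EG.nat_pow_distrib[of P Q l] by (auto simp: ec_mult_eq_pow curve_add)
qed auto

lemma comm_group_torsion_group: "comm_group (torsion_group l)"
proof (rule group.group_comm_groupI)
  show "group (torsion_group l)"
    unfolding torsion_group_def by (rule subgroup.subgroup_is_group[OF subgroup_torsion EG.is_group])
qed (auto intro: add_commute)

lemma torsion_group_pow: "P [^]\<^bsub>torsion_group l\<^esub> (n::nat) = P [^]\<^bsub>curve_group\<^esub> n"
  by (induction n) (simp_all add: nat_pow_def)

lemma inv_torsion_group:
  assumes "P \<in> carrier (torsion_group l)"
  shows "inv\<^bsub>torsion_group l\<^esub> P = ec_neg P"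
proof -
  have "ec_neg P \<in> carrier (torsion_group l)"
    using subgroup.m_inv_closed[OF subgroup_torsion[of l], of P] assms by (simp add: inv_curve_group)
  then show ?thesis
    using assms comm_group_torsion_group[of l]
    by (intro group.inv_equality) (auto simp: comm_group_def)
qed

end

section \<open>Multiplication on \<open>x\<close>-coordinates\<close>

text \<open>The coefficient \<open>c\<close> may be zero and \<open>d\<close> is only a bound for
  the degree. This keeps the bookkeeping valid when \<open>n ^ 2\<close> vanishes in the field, and
  under cancellation.\<close>

definition has_top_coeff :: "'r::comm_ring_1 poly \<Rightarrow> nat \<Rightarrow> 'r \<Rightarrow> bool" where
  "has_top_coeff p d c \<longleftrightarrow> degree p \<le> d \<and> coeff p d = c"

lemma has_top_coeff_mult:
  assumes "has_top_coeff p d c" "has_top_coeff q e c'"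
  shows "has_top_coeff (p * q) (d + e) (c * c')"
proof -
  have "coeff (p * q) (d + e) = (\<Sum>i\<le>d + e. if i = d then coeff p d * coeff q e else 0)"
    unfolding coeff_mult
  proof (rule sum.cong)
    fix i assume "i \<in> {..d + e}"
    consider "i < d" | "i = d" | "i > d" by linarith
    then show "coeff p i * coeff q (d + e - i) = (if i = d then coeff p d * coeff q e else 0)"
      using assms by cases (auto simp: has_top_coeff_def coeff_eq_0)
  qed simp
  moreover have "degree (p * q) \<le> d + e"
    using degree_mult_le[of p q] assms by (simp add: has_top_coeff_def)
  ultimately show ?thesis using assms by (simp add: has_top_coeff_def)
qed

lemma has_top_coeff_add:
  "has_top_coeff p d c \<Longrightarrow> has_top_coeff q d c' \<Longrightarrow> has_top_coeff (p + q) d (c + c')"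
  by (auto simp: has_top_coeff_def degree_add_le)

lemma has_top_coeff_diff:
  "has_top_coeff p d c \<Longrightarrow> has_top_coeff q d c' \<Longrightarrow> has_top_coeff (p - q) d (c - c')"
  by (auto simp: has_top_coeff_def degree_diff_le)

lemma has_top_coeff_const: "has_top_coeff [:c:] 0 c"
  by (simp add: has_top_coeff_def)

lemma has_top_coeff_X: "has_top_coeff [:0, 1:] 1 1"
  by (simp add: has_top_coeff_def)

lemma has_top_coeff_raise: "has_top_coeff p d c \<Longrightarrow> d < e \<Longrightarrow> has_top_coeff p e 0"
  by (simp add: has_top_coeff_def coeff_eq_0)

lemma has_top_coeff_cong: "has_top_coeff p d c \<Longrightarrow> d = e \<Longrightarrow> c = c' \<Longrightarrow> has_top_coeff p e c'"
  by simp

text \<open>\<open>x_ratio P A B\<close>: the \<open>x\<close>-coordinate of \<open>P\<close> is \<open>(A : B)\<close>, as a point of the projective line.\<close>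

definition x_ratio :: "'f::field ec_point \<Rightarrow> 'f \<Rightarrow> 'f \<Rightarrow> bool" where
  "x_ratio P A B \<longleftrightarrow> (case P of Infinity \<Rightarrow> B = 0 \<and> A \<noteq> 0 | Affine x y \<Rightarrow> B \<noteq> 0 \<and> A = x * B)"

text \<open>The duplication formula
  \<open>((x ^ 2 - a) ^ 2 - 8 * b * x) / (4 * (x ^ 3 + a * x + b))\<close>, homogenised with
  \<open>x = A / B\<close>. Stated over a ring, numerator and denominator apply both to polynomials
  and to their values.\<close>

definition x_dbl_num :: "'r::comm_ring_1 \<Rightarrow> 'r \<Rightarrow> 'r \<Rightarrow> 'r \<Rightarrow> 'r" where
  "x_dbl_num a b A B = (A * A - a * (B * B)) * (A * A - a * (B * B)) - b * (8 * (A * (B * (B * B))))"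

definition x_dbl_den :: "'r::comm_ring_1 \<Rightarrow> 'r \<Rightarrow> 'r \<Rightarrow> 'r \<Rightarrow> 'r" where
  "x_dbl_den a b A B = 4 * (B * (A * (A * A) + a * (A * (B * B)) + b * (B * (B * B))))"

definition x_add_den :: "'r::comm_ring_1 \<Rightarrow> 'r \<Rightarrow> 'r \<Rightarrow> 'r \<Rightarrow> 'r" where
  "x_add_den A B A' B' = (A * B' - A' * B) * (A * B' - A' * B)"

text \<open>Differential addition: the sum of the x-coordinates of P + Q and P - Q is a symmetric
  rational function of those of P and Q. Here \<open>x\<close> is the x-coordinate of the
  difference.\<close>

definition x_add_num :: "'r::comm_ring_1 \<Rightarrow> 'r \<Rightarrow> 'r \<Rightarrow> 'r \<Rightarrow> 'r \<Rightarrow> 'r \<Rightarrow> 'r \<Rightarrow> 'r" where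
  "x_add_num a b x A B A' B' =
     2 * ((A * A' + a * (B * B')) * (A * B' + A' * B) + b * (2 * ((B * B') * (B * B'))))
     - x * x_add_den A B A' B'"

section \<open>Doubling and differential addition on the projective x-line\<close>

context elliptic_curve
begin

lemma four: "(4::'f) \<noteq> 0"
  using two by (metis mult_eq_0_iff mult_2_right numeral_Bit0)

lemma x_ratio_double:
  assumes P: "curve P" and r: "x_ratio P A B"
  shows "x_ratio (P \<boxplus> P) (x_dbl_num a b A B) (x_dbl_den a b A B)"
proof (cases P)
  case Infinity
  then show ?thesis using r by (simp add: x_ratio_def x_dbl_num_def x_dbl_den_def)
next
  case (Affine x y)
  have c: "y ^ 2 = x ^ 3 + a * x + b" using P Affine by (simp add: on_curve_Affine)
  have B: "B \<noteq> 0" and A: "A = x * B" using r Affine by (auto simp: x_ratio_def)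
  have num: "x_dbl_num a b A B = B ^ 4 * ((x ^ 2 - a) ^ 2 - 8 * b * x)"
    unfolding x_dbl_num_def A by Groebner_Basis.algebra
  have den: "x_dbl_den a b A B = B ^ 4 * (4 * y ^ 2)"
    unfolding x_dbl_den_def A c by Groebner_Basis.algebra
  show ?thesis
  proof (cases "y = 0")
    case True
    \<comment> \<open>At a point of order two the denominator vanishes. The numerator is the square
      of the derivative of the cubic, hence nonzero, as \<open>x_ratio\<close> requires at
      \<open>Infinity\<close>.\<close>
    have "(x ^ 2 - a) ^ 2 - 8 * b * x = (3 * x ^ 2 + a) ^ 2"
      using c True by Groebner_Basis.algebra
    moreover have "3 * x ^ 2 + a \<noteq> 0" using smooth[of x] c True by auto
    ultimately show ?thesis using True Affine B unfolding num den by (simp add: x_ratio_def)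
  next
    case False
    then have "y \<noteq> - y" using two by (metis add.right_inverse mult_2 mult_eq_0_iff)
    then have "P \<boxplus> P \<noteq> Infinity" unfolding ec_add_eq_Infinity_iff Affine by simp
    then obtain m where m: "m * (y + y) = x ^ 2 + x * x + x ^ 2 + a"
      "P \<boxplus> P = Affine (m ^ 2 - x - x) (m * (x - (m ^ 2 - x - x)) - y)"
      using ec_add_obtain_slope[of x y x y] P Affine by auto
    have "(x ^ 2 - a) ^ 2 - 8 * b * x = (m ^ 2 - x - x) * (4 * y ^ 2)"
      using m(1) c by Groebner_Basis.algebra
    then show ?thesis
      unfolding num den m(2) using B False four by (simp add: x_ratio_def)
  qed
qed

lemma x_ratio_add:
  assumes P: "curve P" "x_ratio P A B" and Q: "curve Q" "x_ratio Q A' B'"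
    and d: "P \<boxplus> ec_neg Q = Affine x y"
  shows "x_ratio (P \<boxplus> Q) (x_add_num a b x A B A' B') (x_add_den A B A' B')"
proof -
  consider "P = Infinity" | "Q = Infinity"
    | x1 y1 x2 y2 where "P = Affine x1 y1" "Q = Affine x2 y2"
    by (cases P; cases Q) auto
  then show ?thesis
  proof cases
    case 1
    then obtain y' where "Q = Affine x y'" using d by (cases Q) auto
    then show ?thesis using 1 P(2) Q(2)
      by (auto simp: x_ratio_def x_add_num_def x_add_den_def algebra_simps)
  next
    case 2
    then show ?thesis using d P(2) Q(2)
      by (auto simp: x_ratio_def x_add_num_def x_add_den_def algebra_simps)
  next
    case 3
    have c: "y1 ^ 2 = x1 ^ 3 + a * x1 + b" "y2 ^ 2 = x2 ^ 3 + a * x2 + b"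
      using P Q 3 by (simp_all add: on_curve_Affine)
    have B: "B \<noteq> 0" "B' \<noteq> 0" and A: "A = x1 * B" "A' = x2 * B'"
      using P(2) Q(2) 3 by (auto simp: x_ratio_def)
    have den: "x_add_den A B A' B' = (B * B') ^ 2 * (x1 - x2) ^ 2"
      unfolding x_add_den_def A by Groebner_Basis.algebra
    have num: "x_add_num a b x A B A' B' =
        (B * B') ^ 2 * (2 * ((x1 * x2 + a) * (x1 + x2) + 2 * b) - x * (x1 - x2) ^ 2)"
      unfolding x_add_num_def x_add_den_def A by Groebner_Basis.algebra
    show ?thesis
    proof (cases "x1 = x2")
      case True
      \<comment> \<open>As the difference of the points is affine, they are distinct; so they are
        inverse to each other and not of order two.\<close>
      then have "y1 = y2 \<or> y1 = - y2" using c by (metis power2_eq_iff)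
      moreover have "y1 \<noteq> y2" using d 3 True by auto
      ultimately have y: "y1 = - y2" "y2 \<noteq> 0" by auto
      have "2 * ((x2 * x2 + a) * (x2 + x2) + 2 * b) = (2 * y2) * (2 * y2)"
        using c(2) by Groebner_Basis.algebra
      then show ?thesis unfolding num den using 3 True y B four by (simp add: x_ratio_def)
    next
      case False
      define m m' where "m = (y1 - y2) / (x1 - x2)" and "m' = (y1 + y2) / (x1 - x2)"
      have m: "m * (x1 - x2) = y1 - y2" "m' * (x1 - x2) = y1 + y2"
        using False by (simp_all add: m_def m'_def)
      have x: "x = m' ^ 2 - x1 - x2"
        using d False unfolding 3 by (auto simp: Let_def line_slope_def m'_def)
      obtain y' where s: "P \<boxplus> Q = Affine (m ^ 2 - x1 - x2) y'"
        using False unfolding 3 by (auto simp: Let_def line_slope_def m_def)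
      have "2 * ((x1 * x2 + a) * (x1 + x2) + 2 * b) - x * (x1 - x2) ^ 2 =
          (m ^ 2 - x1 - x2) * (x1 - x2) ^ 2"
        using m c unfolding x by Groebner_Basis.algebra
      then show ?thesis unfolding num den s using False B by (simp add: x_ratio_def)
    qed
  qed
qed

text \<open>The square of the \<open>n\<close>-th division polynomial, obtained by differential addition
  (the Montgomery ladder), which needs no \<open>y\<close>-coordinates and no divisions.\<close>

lemma multiplication_polys_exist:
  assumes "n > 0"
  obtains A B where "has_top_coeff A (n ^ 2) 1" "has_top_coeff B (n ^ 2 - 1) (of_nat (n ^ 2))"
    and "\<And>x y. curve (Affine x y) \<Longrightarrow> x_ratio (ec_mult a n (Affine x y)) (poly A x) (poly B x)"
proof -
  have "\<exists>A B. has_top_coeff A (n ^ 2) 1 \<and> has_top_coeff B (n ^ 2 - 1) (of_nat (n ^ 2)) \<and>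
      (\<forall>x y. curve (Affine x y) \<longrightarrow> x_ratio (ec_mult a n (Affine x y)) (poly A x) (poly B x))"
    using assms
  proof (induction n rule: less_induct)
    case (less n)
    \<comment> \<open>An even multiple is a doubling. An odd one is the sum of the multiples by
      \<open>k + 1\<close> and \<open>k\<close>, whose difference is the original point.\<close>
    consider "n = 1" | k where "k > 0" "n = 2 * k" | k where "k > 0" "n = 2 * k + 1"
      using less.prems by (metis One_nat_def add.commute add_cancel_right_left evenE gr0I mult_0_right oddE)
    then show ?case
    proof cases
      case 1
      then show ?thesis using has_top_coeff_X has_top_coeff_const[of 1]
        by (intro exI[of _ "[:0, 1:]"] exI[of _ "[:1:]"]) (auto simp: ec_mult_def x_ratio_def)
    next
      case (2 k)
      then obtain A B where AB: "has_top_coeff A (k ^ 2) 1" "has_top_coeff B (k ^ 2 - 1) (of_nat (k ^ 2))"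
        "\<And>x y. curve (Affine x y) \<Longrightarrow> x_ratio (ec_mult a k (Affine x y)) (poly A x) (poly B x)"
        using less.IH[of k] by auto
      obtain d where d: "k ^ 2 = Suc d" using 2 by (metis gr0_conv_Suc zero_less_power)
      have A: "has_top_coeff A (d + 1) 1" and B: "has_top_coeff B d (of_nat (k ^ 2))"
        using AB(1,2) d by simp_all
      note AA = has_top_coeff_mult[OF A A] and BB = has_top_coeff_mult[OF B B]
      note cst = has_top_coeff_mult[OF has_top_coeff_const]
      have n2: "n ^ 2 = 4 * d + 4" using 2 d by (simp add: power_mult_distrib)
      then have n2': "n ^ 2 = 2 * d + 2 + (2 * d + 2)" by simp
      let ?A = "x_dbl_num [:a:] [:b:] A B" and ?B = "x_dbl_den [:a:] [:b:] A B"
      \<comment> \<open>The terms with \<open>a\<close> or \<open>b\<close> lie below the top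
        degree, so the numerator keeps the leading coefficient 1 of \<open>A ^ 4\<close>.\<close>
      have "has_top_coeff (A * A - [:a:] * (B * B)) (2 * d + 2) 1"
        by (rule has_top_coeff_cong[OF has_top_coeff_diff[OF AA
              has_top_coeff_raise[OF cst[OF BB]]]]) auto
      note sq = has_top_coeff_mult[OF this this]
      have "has_top_coeff ([:8 * b:] * (A * (B * (B * B)))) (2 * d + 2 + (2 * d + 2)) 0"
        by (rule has_top_coeff_raise[OF cst[OF has_top_coeff_mult[OF A has_top_coeff_mult[OF B BB]]]]) auto
      from has_top_coeff_diff[OF sq this] have "has_top_coeff ?A (n ^ 2) 1"
        unfolding x_dbl_num_def n2' by (simp add: numeral_poly)
      moreover have "has_top_coeff ?B (n ^ 2 - 1) (of_nat (n ^ 2))"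
      proof -
        have 1: "has_top_coeff ([:a:] * (A * (B * B))) (d + 1 + (d + 1 + (d + 1))) 0"
          by (rule has_top_coeff_raise[OF cst[OF has_top_coeff_mult[OF A BB]]]) auto
        have 2: "has_top_coeff ([:b:] * (B * (B * B))) (d + 1 + (d + 1 + (d + 1))) 0"
          by (rule has_top_coeff_raise[OF cst[OF has_top_coeff_mult[OF B BB]]]) auto
        \<comment> \<open>Only \<open>4 * B * A ^ 3\<close> reaches the top degree, with coefficient
          \<open>4 * k ^ 2 = n ^ 2\<close>.\<close>
        have "has_top_coeff ([:4:] * (B * (A * (A * A) + [:a:] * (A * (B * B)) + [:b:] * (B * (B * B)))))
            (n ^ 2 - 1) (of_nat (n ^ 2))"
          by (rule has_top_coeff_cong[OF cst[OF has_top_coeff_mult[OF B has_top_coeff_add[OF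
                has_top_coeff_add[OF has_top_coeff_mult[OF A AA] 1] 2]]]])
            (simp add: n2, simp add: \<open>n = 2 * k\<close> power_mult_distrib)
        then show ?thesis unfolding x_dbl_den_def by (simp add: numeral_poly)
      qed
      moreover have "x_ratio (ec_mult a n (Affine x y)) (poly ?A x) (poly ?B x)"
        if "curve (Affine x y)" for x y
      proof -
        have "ec_mult a n (Affine x y) = ec_mult a k (Affine x y) \<boxplus> ec_mult a k (Affine x y)"
          using EG.nat_pow_mult[of "Affine x y" k k] that 2 by (simp add: ec_mult_eq_pow mult_2)
        moreover have "curve (ec_mult a k (Affine x y))"
          using EG.nat_pow_closed[of "Affine x y" k] that by (simp add: ec_mult_eq_pow)
        ultimately show ?thesis
          using x_ratio_double[OF _ AB(3)[OF that]] by (simp add: x_dbl_num_def x_dbl_den_def)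
      qed
      ultimately show ?thesis by blast
    next
      case (3 k)
      then obtain A B where AB: "has_top_coeff A (k ^ 2) 1" "has_top_coeff B (k ^ 2 - 1) (of_nat (k ^ 2))"
        "\<And>x y. curve (Affine x y) \<Longrightarrow> x_ratio (ec_mult a k (Affine x y)) (poly A x) (poly B x)"
        using less.IH[of k] by auto
      obtain A' B' where AB': "has_top_coeff A' ((k + 1) ^ 2) 1"
        "has_top_coeff B' ((k + 1) ^ 2 - 1) (of_nat ((k + 1) ^ 2))"
        "\<And>x y. curve (Affine x y) \<Longrightarrow> x_ratio (ec_mult a (k + 1) (Affine x y)) (poly A' x) (poly B' x)"
        using less.IH[of "k + 1"] 3 by auto
      obtain d where d: "k ^ 2 = Suc d" using 3 by (metis gr0_conv_Suc zero_less_power)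
      obtain e where e: "(k + 1) ^ 2 = Suc e" by (metis gr0_conv_Suc zero_less_power zero_less_Suc add.commute plus_1_eq_Suc)
      define u v :: 'f where "u = of_nat (k ^ 2)" and "v = of_nat ((k + 1) ^ 2)"
      have A: "has_top_coeff A (d + 1) 1" and B: "has_top_coeff B d u"
        using AB(1,2) unfolding u_def d by simp_all
      have A': "has_top_coeff A' (e + 1) 1" and B': "has_top_coeff B' e v"
        using AB'(1,2) unfolding v_def e by simp_all
      note cst = has_top_coeff_mult[OF has_top_coeff_const]
      have n2: "n ^ 2 = 2 * d + 2 * e + 3"
      proof -
        have "n ^ 2 + 1 = 2 * k ^ 2 + 2 * (k + 1) ^ 2" using 3 by (simp add: power2_eq_square algebra_simps)
        then show ?thesis using d e by simp
      qed
      \<comment> \<open>These are the top coefficients of numerator and denominator; they come out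
        right because \<open>v - u\<close> is \<open>2 * k + 1 = n\<close>.\<close>
      have uv: "2 * (v + u) - (u - v) * (u - v) = 1" "(u - v) * (u - v) = of_nat (n ^ 2)"
        unfolding u_def v_def 3 of_nat_power of_nat_add of_nat_mult of_nat_1 of_nat_numeral
        by (Groebner_Basis.algebra, Groebner_Basis.algebra)
      \<comment> \<open>The known difference is the point \<open>Affine x y\<close> itself, so its
        x-coordinate enters as the polynomial variable.\<close>
      let ?B = "x_add_den A' B' A B" and ?A = "x_add_num [:a:] [:b:] [:0, 1:] A' B' A B"
      have A'B: "has_top_coeff (A' * B) (d + e + 1) u"
        by (rule has_top_coeff_cong[OF has_top_coeff_mult[OF A' B]]) simp_all
      have AB'': "has_top_coeff (A * B') (d + e + 1) v"
        by (rule has_top_coeff_cong[OF has_top_coeff_mult[OF A B']]) simp_all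
      note D = has_top_coeff_diff[OF A'B AB'']
      have den: "has_top_coeff ?B (n ^ 2 - 1) (of_nat (n ^ 2))"
        unfolding x_add_den_def
        by (rule has_top_coeff_cong[OF has_top_coeff_mult[OF D D]]) (simp add: n2, rule uv(2))
      have 1: "has_top_coeff (A' * A + [:a:] * (B' * B)) (d + e + 2) 1"
        by (rule has_top_coeff_cong[OF has_top_coeff_add[OF has_top_coeff_mult[OF A' A]
              has_top_coeff_raise[OF cst[OF has_top_coeff_mult[OF B' B]]]]]) auto
      have 2: "has_top_coeff ([:2 * b:] * ((B' * B) * (B' * B))) (d + e + 2 + (d + e + 1)) 0"
        by (rule has_top_coeff_raise[OF cst[OF has_top_coeff_mult[OF
              has_top_coeff_mult[OF B' B] has_top_coeff_mult[OF B' B]]]]) auto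
      have 3: "has_top_coeff ([:2:] * ((A' * A + [:a:] * (B' * B)) * (A' * B + A * B') +
          [:2 * b:] * ((B' * B) * (B' * B)))) (n ^ 2) (2 * (v + u))"
        by (rule has_top_coeff_cong[OF cst[OF has_top_coeff_add[OF has_top_coeff_mult[OF 1
              has_top_coeff_add[OF A'B AB'']] 2]]]) (simp_all add: n2 add.commute)
      have 4: "has_top_coeff ([:0, 1:] * ?B) (n ^ 2) ((u - v) * (u - v))"
        by (rule has_top_coeff_cong[OF has_top_coeff_mult[OF has_top_coeff_X den]]) (simp_all add: n2 uv(2))
      have "has_top_coeff ?A (n ^ 2) 1"
        using has_top_coeff_diff[OF 3 4] unfolding uv(1) x_add_num_def by (simp add: numeral_poly)
      moreover have "x_ratio (ec_mult a n (Affine x y)) (poly ?A x) (poly ?B x)"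
        if "curve (Affine x y)" for x y
      proof -
        let ?P = "ec_mult a (k + 1) (Affine x y)" and ?Q = "ec_mult a k (Affine x y)"
        have PQ: "curve ?P" "curve ?Q"
          using EG.nat_pow_closed[of "Affine x y" k] EG.nat_pow_closed[of "Affine x y" "k + 1"] that
          by (simp_all add: ec_mult_eq_pow)
        have "ec_mult a n (Affine x y) = ?P \<boxplus> ?Q"
          using EG.nat_pow_mult[of "Affine x y" "k + 1" k] that \<open>n = 2 * k + 1\<close>
          by (simp add: ec_mult_eq_pow mult_2)
        moreover have "?P = Affine x y \<boxplus> ?Q" by (simp add: ec_mult_def)
        then have "?P \<boxplus> ec_neg ?Q = Affine x y" using add_neg_cancel[OF that PQ(2)] by simp
        from x_ratio_add[OF PQ(1) AB'(3)[OF that] PQ(2) AB(3)[OF that] this]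
        have "x_ratio (?P \<boxplus> ?Q) (poly ?A x) (poly ?B x)"
          by (simp add: x_add_num_def x_add_den_def ac_simps)
        ultimately show ?thesis by simp
      qed
      ultimately show ?thesis using den by blast
    qed
  qed
  then show thesis using that by blast
qed

end

section \<open>Existence of torsion points\<close>

locale closed_elliptic_curve = elliptic_curve a b for a b :: "'f::alg_closed_field" +
  assumes three: "(3::'f) \<noteq> 0"
begin

lemma sqrt_exists: "\<exists>y::'f. y ^ 2 = c"
proof -
  have "\<exists>y. poly [:- c, 0, 1:] y = 0" by (rule alg_closed_imp_poly_has_root) simp
  then show ?thesis by (auto simp: power2_eq_square)
qed

text \<open>A root of the denominator \<open>B\<close> is the x-coordinate of the desired point.
  Since \<open>n ^ 2\<close> is nonzero in the field, \<open>B\<close> is not constant.\<close>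

lemma torsion_point_exists:
  assumes "n \<ge> 2" "of_nat n \<noteq> (0::'f)"
  obtains P where "curve P" "P \<noteq> Infinity" "ec_mult a n P = Infinity"
proof -
  obtain A B where AB: "has_top_coeff B (n ^ 2 - 1) (of_nat (n ^ 2))"
    "\<And>x y. curve (Affine x y) \<Longrightarrow> x_ratio (ec_mult a n (Affine x y)) (poly A x) (poly B x)"
    using multiplication_polys_exist[of n] assms by (metis gr0I not_numeral_le_zero)
  have "n ^ 2 \<ge> 2 ^ 2" using assms(1) by (rule power_mono) simp
  moreover have "coeff B (n ^ 2 - 1) \<noteq> 0" using AB(1) assms(2) by (simp add: has_top_coeff_def)
  then have "degree B \<ge> n ^ 2 - 1" by (rule le_degree)
  ultimately have "degree B > 0" by simp
  then obtain x where "poly B x = 0" using alg_closed_imp_poly_has_root by blast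
  moreover obtain y where "y ^ 2 = x ^ 3 + a * x + b" using sqrt_exists by blast
  then have c: "curve (Affine x y)" by (simp add: on_curve_Affine)
  ultimately have "ec_mult a n (Affine x y) = Infinity"
    using AB(2)[OF c] by (auto simp: x_ratio_def split: ec_point.splits)
  with c show thesis using that by blast
qed

section \<open>Points of order two, their halves, and points of order three\<close>

lemma two_torsion_points_exist:
  obtains r s where "r \<noteq> s" "r ^ 3 + a * r + b = 0" "s ^ 3 + a * s + b = 0"
proof -
  have "\<exists>r. poly [:b, a, 0, 1:] r = 0" by (rule alg_closed_imp_poly_has_root) simp
  then obtain r where r: "r ^ 3 + a * r + b = 0" by (auto simp: power3_eq_cube algebra_simps)
  \<comment> \<open>This quadratic is the quotient of the cubic by \<open>X - r\<close>.\<close>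
  have "\<exists>s. poly [:r ^ 2 + a, r, 1:] s = 0" by (rule alg_closed_imp_poly_has_root) simp
  then obtain s where s: "s ^ 2 + r * s + r ^ 2 + a = 0" by (auto simp: power2_eq_square algebra_simps)
  have "r \<noteq> s"
  proof
    assume "r = s"
    then have "3 * r ^ 2 + a = 0" using s by (simp add: power2_eq_square algebra_simps)
    with r show False by (rule smooth)
  qed
  moreover have "s ^ 3 + a * s + b = 0" using r s by Groebner_Basis.algebra
  ultimately show thesis using that r by blast
qed

lemma halve_two_torsion:
  assumes r: "r ^ 3 + a * r + b = 0"
  obtains P where "curve P" "P \<boxplus> P = Affine r 0"
proof -
  \<comment> \<open>In the duplication formula, the numerator of x(2P) - r is the square of
    \<open>(x - r) ^ 2 - (3 * r ^ 2 + a)\<close>; this dictates the choice of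
    \<open>x\<close>.\<close>
  obtain d where d: "d ^ 2 = 3 * r ^ 2 + a" using sqrt_exists by blast
  define x where "x = r + d"
  obtain y where y: "y ^ 2 = x ^ 3 + a * x + b" using sqrt_exists by blast
  have "d \<noteq> 0" using smooth[of r] r d by auto
  have y2: "y ^ 2 = d ^ 2 * (2 * d + 3 * r)"
    using y d r unfolding x_def by Groebner_Basis.algebra
  \<comment> \<open>Otherwise \<open>a\<close> and \<open>b\<close> would be determined by
    \<open>r\<close> in such a way that the discriminant vanishes.\<close>
  have "2 * d + 3 * r \<noteq> 0"
  proof
    assume "2 * d + 3 * r = 0"
    then have "4 * a = - 3 * r ^ 2" using d by Groebner_Basis.algebra
    moreover from this have "4 * b = - (r ^ 3)" using r by Groebner_Basis.algebra
    ultimately have "4 * 4 * (4 * a ^ 3 + 27 * b ^ 2) = 0" by Groebner_Basis.algebra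
    then show False using disc four by (metis mult_eq_0_iff)
  qed
  with y2 \<open>d \<noteq> 0\<close> have "y \<noteq> 0" by auto
  then have "y \<noteq> - y" using two by (metis add.right_inverse mult_2 mult_eq_0_iff)
  then have "Affine x y \<boxplus> Affine x y \<noteq> Infinity" unfolding ec_add_eq_Infinity_iff by simp
  moreover have c: "curve (Affine x y)" using y by (simp add: on_curve_Affine)
  ultimately obtain m where m: "m * (y + y) = x ^ 2 + x * x + x ^ 2 + a"
    "Affine x y \<boxplus> Affine x y = Affine (m ^ 2 - x - x) (m * (x - (m ^ 2 - x - x)) - y)"
    using ec_add_obtain_slope[of x y x y] by auto
  have "x ^ 2 + x * x + x ^ 2 + a = d * (2 * (2 * d + 3 * r))"
    unfolding x_def using d by Groebner_Basis.algebra
  then have "(m * (y + y)) ^ 2 = 4 * (y ^ 2 * (2 * d + 3 * r))"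
    unfolding m(1) y2 by Groebner_Basis.algebra
  then have "(4 * y ^ 2) * m ^ 2 = (4 * y ^ 2) * (2 * d + 3 * r)" by Groebner_Basis.algebra
  then have "m ^ 2 = 2 * d + 3 * r" using four \<open>y \<noteq> 0\<close> by simp
  then have eq: "m ^ 2 - x - x = r" unfolding x_def by Groebner_Basis.algebra
  then obtain y' where y': "Affine x y \<boxplus> Affine x y = Affine r y'" using m(2) by simp
  have "y' ^ 2 = 0" using curve_add[OF c c] r unfolding y' by (simp add: on_curve_Affine)
  then show thesis using that c y' by simp
qed

text \<open>The quartic is the third division polynomial. For \<open>y \<noteq> 0\<close> it says
  that the tangent slope satisfies \<open>m ^ 2 = 3 * x\<close>, so doubling keeps the x-coordinate
  and changes the sign of \<open>y\<close>.\<close>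

lemma three_torsion_point:
  assumes "3 * x ^ 4 + 6 * a * x ^ 2 + 12 * b * x - a ^ 2 = 0" "curve (Affine x y)"
  shows "ec_mult a 3 (Affine x y) = Infinity"
proof -
  let ?P = "Affine x y"
  have c: "y ^ 2 = x ^ 3 + a * x + b" using assms by (simp add: on_curve_Affine)
  have "y \<noteq> 0"
  proof
    assume "y = 0"
    then have "(3 * x ^ 2 + a) ^ 2 = 0" using c assms(1) by Groebner_Basis.algebra
    with smooth[of x] c \<open>y = 0\<close> show False by simp
  qed
  then have "y \<noteq> - y" using two by (metis add.right_inverse mult_2 mult_eq_0_iff)
  then have "?P \<boxplus> ?P \<noteq> Infinity" unfolding ec_add_eq_Infinity_iff by simp
  then obtain m where m: "m * (y + y) = x ^ 2 + x * x + x ^ 2 + a"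
    "?P \<boxplus> ?P = Affine (m ^ 2 - x - x) (m * (x - (m ^ 2 - x - x)) - y)"
    using ec_add_obtain_slope[of x y x y] assms by auto
  have "(4 * y ^ 2) * m ^ 2 = (4 * y ^ 2) * (3 * x)"
    using m(1) c assms(1) by Groebner_Basis.algebra
  moreover have "4 * y ^ 2 \<noteq> 0" using four \<open>y \<noteq> 0\<close> by simp
  ultimately have "m ^ 2 = 3 * x" by (metis mult_left_cancel)
  then have x: "m ^ 2 - x - x = x" by simp
  then have "?P \<boxplus> ?P = ec_neg ?P" using m(2) by simp
  then show ?thesis by (simp add: ec_mult_def numeral_3_eq_3)
qed

text \<open>It suffices to find two distinct roots of the quartic, since points with different
  x-coordinates are neither equal nor inverse to each other.\<close>

lemma three_torsion_points_exist:
  obtains P Q where "curve P" "curve Q" "P \<noteq> Infinity" "Q \<noteq> Infinity" "P \<noteq> Q" "P \<noteq> ec_neg Q"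
    "ec_mult a 3 P = Infinity" "ec_mult a 3 Q = Infinity"
proof -
  define f where "f x = 3 * x ^ 4 + 6 * a * x ^ 2 + 12 * b * x - a ^ 2" for x
  have "\<exists>r. poly [:- (a ^ 2), 12 * b, 6 * a, 0, 3:] r = 0"
    using three by (intro alg_closed_imp_poly_has_root) simp
  then obtain r where r: "f r = 0"
    unfolding f_def by (auto simp: power4_eq_xxxx power2_eq_square algebra_simps)
  \<comment> \<open>The cubic is the quotient of the quartic by \<open>X - r\<close>. The quadratic
    below arises from a further division by \<open>X - r\<close> and is used when
    \<open>s = r\<close>. A triple root \<open>r\<close> would contradict smoothness.\<close>
  have "\<exists>s. poly [:3 * r ^ 3 + 6 * a * r + 12 * b, 3 * r ^ 2 + 6 * a, 3 * r, 3:] s = 0"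
    using three by (intro alg_closed_imp_poly_has_root) simp
  then obtain s where s: "3 * s ^ 3 + 3 * r * s ^ 2 + (3 * r ^ 2 + 6 * a) * s + 3 * r ^ 3 + 6 * a * r + 12 * b = 0"
    by (auto simp: power3_eq_cube power2_eq_square algebra_simps)
  have "\<exists>t. poly [:9 * r ^ 2 + 6 * a, 6 * r, 3:] t = 0"
    using three by (intro alg_closed_imp_poly_has_root) simp
  then obtain t where t: "3 * t ^ 2 + 6 * r * t + 9 * r ^ 2 + 6 * a = 0"
    by (auto simp: power2_eq_square algebra_simps)
  have "\<exists>s. s \<noteq> r \<and> f s = 0"
  proof (cases "s = r")
    case False
    moreover have "f s = 0" using r s unfolding f_def by Groebner_Basis.algebra
    ultimately show ?thesis by blast
  next
    case True
    then have "12 * (r ^ 3 + a * r + b) = 0" using s by (simp add: power2_eq_square power3_eq_cube algebra_simps)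
    moreover have "(12::'f) = 4 * 3" by simp
    ultimately have r3: "r ^ 3 + a * r + b = 0" using three four by (metis mult_eq_0_iff)
    have "t \<noteq> r"
    proof
      assume "t = r"
      then have "6 * (3 * r ^ 2 + a) = 0" using t by (simp add: power2_eq_square algebra_simps)
      moreover have "(6::'f) = 2 * 3" by simp
      ultimately have "3 * r ^ 2 + a = 0" using three two by (metis mult_eq_0_iff)
      with r3 show False by (rule smooth)
    qed
    moreover have "f t = 0" using r r3 t unfolding f_def by Groebner_Basis.algebra
    ultimately show ?thesis by blast
  qed
  then obtain s' where s': "s' \<noteq> r" "f s' = 0" by blast
  obtain y z where "y ^ 2 = r ^ 3 + a * r + b" "z ^ 2 = s' ^ 3 + a * s' + b"
    using sqrt_exists by metis
  then have "curve (Affine r y)" "curve (Affine s' z)" by (simp_all add: on_curve_Affine)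
  then show thesis
    using that[of "Affine r y" "Affine s' z"] three_torsion_point r s' unfolding f_def by auto
qed

end

section \<open>Membership of the coordinates\<close>

lemma (in group) pow_coprime_eq_one:
  fixes m n :: nat
  assumes "x \<in> carrier G" "x [^] m = \<one>" "x [^] n = \<one>" "coprime m n"
  shows "x = \<one>"
proof -
  have "ord x dvd m" "ord x dvd n" using assms by (simp_all add: pow_eq_id)
  then have "ord x = 1" using coprime_common_divisor[OF assms(4)] by simp
  then show ?thesis using assms(1) pow_ord_eq_1[of x] by simp
qed

context elliptic_curve
begin

lemma slope_equations:
  assumes "curve P" "curve Q" "P \<noteq> Infinity" "Q \<noteq> Infinity" "P \<boxplus> Q \<noteq> Infinity"
  shows "line_slope a P Q ^ 2 = xc P + xc Q + xc (P \<boxplus> Q)"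
    and "line_slope a P Q * (xc P - xc Q) = yc P - yc Q"
    and "line_slope a P Q * (yc P + yc Q) = xc P ^ 2 + xc P * xc Q + xc Q ^ 2 + a"
proof -
  obtain x1 y1 x2 y2 where PQ: "P = Affine x1 y1" "Q = Affine x2 y2"
    using assms(3,4) by (metis ec_point.exhaust)
  obtain m where m: "m = line_slope a P Q" "m * (x1 - x2) = y1 - y2"
    "m * (y1 + y2) = x1 ^ 2 + x1 * x2 + x2 ^ 2 + a"
    and "P \<boxplus> Q = Affine (m ^ 2 - x1 - x2) (m * (x1 - (m ^ 2 - x1 - x2)) - y1)"
    using ec_add_obtain_slope[of x1 y1 x2 y2] assms(1,2,5) unfolding PQ by blast
  then have "xc (P \<boxplus> Q) = m ^ 2 - x1 - x2" by (metis ec_point.sel(1))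
  moreover have "xc P = x1" "xc Q = x2" "yc P = y1" "yc Q = y2" by (simp_all add: PQ)
  ultimately show "line_slope a P Q ^ 2 = xc P + xc Q + xc (P \<boxplus> Q)"
    and "line_slope a P Q * (xc P - xc Q) = yc P - yc Q"
    and "line_slope a P Q * (yc P + yc Q) = xc P ^ 2 + xc P * xc Q + xc Q ^ 2 + a"
    using m by simp_all
qed

lemma torsion_of_dvd:
  assumes "curve P" "ec_mult a n P = Infinity" "n dvd l"
  shows "P \<in> carrier (torsion_group l)"
proof -
  obtain j where "l = n * j" using assms(3) by blast
  then have "P [^]\<^bsub>curve_group\<^esub> l = Infinity"
    using EG.nat_pow_pow[of P n j] EG.nat_pow_one[of j] assms by (simp add: ec_mult_eq_pow)
  then show ?thesis using assms by (simp add: ec_mult_eq_pow)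
qed

end

context closed_elliptic_curve
begin

text \<open>Independence only means being distinct up to sign. Points of order two or three do if 2
  or 3 divides \<open>l\<close>. Otherwise a single \<open>P\<close> gives the pair
  \<open>P\<close>, \<open>P \<boxplus> P\<close>, because neither twice nor three times
  \<open>P\<close> vanishes.\<close>

lemma independent_torsion_points:
  assumes l: "l \<ge> 3" "of_nat l \<noteq> (0::'f)"
  obtains P Q where "P \<in> carrier (torsion_group l)" "Q \<in> carrier (torsion_group l)"
    "P \<noteq> Infinity" "Q \<noteq> Infinity" "P \<noteq> Q" "P \<noteq> ec_neg Q"
proof -
  consider "even l" | "3 dvd l" | "odd l" "\<not> 3 dvd l" by blast
  then show thesis
  proof cases
    case 1
    obtain r s where rs: "r \<noteq> s" "r ^ 3 + a * r + b = 0" "s ^ 3 + a * s + b = 0"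
      by (rule two_torsion_points_exist)
    have "ec_mult a 2 (Affine t 0) = Infinity" for t
      by (simp add: ec_mult_def numeral_2_eq_2)
    then have "Affine r 0 \<in> carrier (torsion_group l)" "Affine s 0 \<in> carrier (torsion_group l)"
      using torsion_of_dvd[of _ 2 l] rs 1 by (auto simp: on_curve_Affine)
    then show thesis using that rs(1) by simp
  next
    case 2
    then show thesis using three_torsion_points_exist torsion_of_dvd that by metis
  next
    case 3
    obtain P where P: "curve P" "P \<noteq> Infinity" "ec_mult a l P = Infinity"
      using torsion_point_exists[of l] l by auto
    have "coprime 2 l" "coprime 3 l"
      using 3 prime_imp_coprime[of 2 l] prime_imp_coprime[of 3 l] by auto
    then have "P [^]\<^bsub>curve_group\<^esub> (2::nat) \<noteq> Infinity" "P [^]\<^bsub>curve_group\<^esub> (3::nat) \<noteq> Infinity"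
      using EG.pow_coprime_eq_one[of P 2 l] EG.pow_coprime_eq_one[of P 3 l] P
      by (auto simp: ec_mult_eq_pow)
    then have nz: "P \<boxplus> P \<noteq> Infinity" "P \<boxplus> P \<boxplus> P \<noteq> Infinity"
      using P(1) by (simp_all add: numeral_2_eq_2 numeral_3_eq_3)
    have "P \<noteq> P \<boxplus> P"
    proof
      assume "P = P \<boxplus> P"
      then have "P \<boxplus> P \<boxplus> ec_neg P = Infinity" by simp
      then show False using add_neg_cancel[OF P(1) P(1)] P(2) by simp
    qed
    moreover have "P \<noteq> ec_neg (P \<boxplus> P)"
      using nz(2) by (metis ec_add_eq_Infinity_iff ec_neg_eq_iff)
    moreover have "P \<boxplus> P \<in> carrier (torsion_group l)"
      using subgroup.m_closed[OF subgroup_torsion[of l], of P P] P by simp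
    ultimately show thesis using that[of P "P \<boxplus> P"] P nz(1) by simp
  qed
qed

section \<open>From the slopes to the coordinates\<close>

lemma x_relations_torsion:
  assumes alg: "\<And>u v. u \<in> S \<Longrightarrow> v \<in> S \<Longrightarrow> u + v \<in> S" "\<And>u v. u \<in> S \<Longrightarrow> v \<in> S \<Longrightarrow> u * v \<in> S"
    and cst: "-1 \<in> S" "1 / 2 \<in> S" "1 / 3 \<in> S"
    and slopes: "\<And>P Q. P \<in> carrier (torsion_group l) \<Longrightarrow> Q \<in> carrier (torsion_group l) \<Longrightarrow>
      P \<noteq> Infinity \<Longrightarrow> Q \<noteq> Infinity \<Longrightarrow> P \<boxplus> Q \<noteq> Infinity \<Longrightarrow> line_slope a P Q \<in> S"
  shows "x_relations (torsion_group l) xc S"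
proof -
  interpret T: comm_group "torsion_group l" by (rule comm_group_torsion_group)
  show ?thesis
  proof unfold_locales
    show "0 \<in> S" using alg(1)[OF alg(2)[OF cst(1) cst(1)] cst(1)] by simp
    show "u - v \<in> S" if "u \<in> S" "v \<in> S" for u v
      using alg(1)[OF that(1) alg(2)[OF cst(1) that(2)]] by simp
    show "u \<in> S" if "2 * u \<in> S" for u using alg(2)[OF cst(2) that] two by simp
    show "u \<in> S" if "3 * u \<in> S" for u using alg(2)[OF cst(3) that] three by simp
    show "xc (inv\<^bsub>torsion_group l\<^esub> P) = xc P"
      if "P \<in> carrier (torsion_group l)" "P \<noteq> \<one>\<^bsub>torsion_group l\<^esub>" for P
      using inv_torsion_group[OF that(1)] that(2) by simp
    show "xc P + xc Q + xc (P \<otimes>\<^bsub>torsion_group l\<^esub> Q) \<in> S"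
      if PQ: "P \<in> carrier (torsion_group l)" "Q \<in> carrier (torsion_group l)"
        and nz: "P \<noteq> \<one>\<^bsub>torsion_group l\<^esub>" "Q \<noteq> \<one>\<^bsub>torsion_group l\<^esub>"
          "P \<otimes>\<^bsub>torsion_group l\<^esub> Q \<noteq> \<one>\<^bsub>torsion_group l\<^esub>" for P Q
    proof -
      have "line_slope a P Q ^ 2 \<in> S"
        using alg(2) slopes[OF PQ] nz by (simp add: power2_eq_square)
      then show ?thesis using slope_equations(1)[of P Q] PQ nz by simp
    qed
  qed
qed

theorem torsion_coordinates_mem:
  assumes l: "l \<ge> 3" "of_nat l \<noteq> (0::'f)"
    and alg: "\<And>u v. u \<in> S \<Longrightarrow> v \<in> S \<Longrightarrow> u + v \<in> S" "\<And>u v. u \<in> S \<Longrightarrow> v \<in> S \<Longrightarrow> u * v \<in> S"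
    and cst: "-1 \<in> S" "1 / 2 \<in> S" "1 / 3 \<in> S"
    and slopes: "\<And>P Q. P \<in> carrier (torsion_group l) \<Longrightarrow> Q \<in> carrier (torsion_group l) \<Longrightarrow>
      P \<noteq> Infinity \<Longrightarrow> Q \<noteq> Infinity \<Longrightarrow> P \<boxplus> Q \<noteq> Infinity \<Longrightarrow> line_slope a P Q \<in> S"
  shows "\<And>P. P \<in> carrier (torsion_group l) \<Longrightarrow> P \<noteq> Infinity \<Longrightarrow> xc P \<in> S \<and> yc P \<in> S"
    and "a \<in> S" "b \<in> S"
proof -
  interpret x_relations "torsion_group l" xc S
    using x_relations_torsion[of S l] alg cst slopes by blast
  have x: "xc P \<in> S" if P: "P \<in> carrier (torsion_group l)" "P \<noteq> Infinity" for P
  proof (cases "4 dvd l")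
    case True
    obtain r s where rs: "r \<noteq> s" "r ^ 3 + a * r + b = 0" "s ^ 3 + a * s + b = 0"
      by (rule two_torsion_points_exist)
    obtain R R' where R: "curve R" "R \<boxplus> R = Affine r 0" and R': "curve R'" "R' \<boxplus> R' = Affine s 0"
      using halve_two_torsion[OF rs(2)] halve_two_torsion[OF rs(3)] by metis
    have four_R: "ec_mult a 4 R = Infinity" if "curve R" "R \<boxplus> R = Affine r 0" for R r
    proof -
      have "ec_mult a 4 R = (R \<boxplus> R) \<boxplus> (R \<boxplus> R)"
        using that(1) add_assoc[of R R "R \<boxplus> R"] curve_add[of R R]
        by (simp add: ec_mult_def numeral_eq_Suc del: ec_add.simps)
      then show ?thesis using that by simp
    qed
    have "R \<in> carrier (torsion_group l)" "R' \<in> carrier (torsion_group l)"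
      using torsion_of_dvd[OF _ four_R True] R R' by blast+
    then show ?thesis
      using f_mem_of_halved_involutions[of R R' "Affine r 0" "Affine s 0" P] R R' rs(1) P by simp
  next
    case False
    \<comment> \<open>As 4 does not divide \<open>l\<close>, either \<open>l\<close> or its half is
      odd, and \<open>l \<ge> 3\<close> makes that number at least 2.\<close>
    obtain m where m: "odd m" "m dvd l" "m \<ge> 2"
    proof (cases "even l")
      case True
      then obtain m where "l = 2 * m" by blast
      then show thesis using that[of m] False l(1) by (auto elim!: evenE)
    qed (use that[of l] l in auto)
    have "of_nat m \<noteq> (0::'f)" using m(2) l(2) by auto
    then obtain R where R: "curve R" "R \<noteq> Infinity" "ec_mult a m R = Infinity"
      using torsion_point_exists[of m] m by blast
    obtain j where "m = 2 * j + 1" using m(1) by (rule oddE)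
    then have "R [^]\<^bsub>torsion_group l\<^esub> (2 * j + 1) = Infinity"
      using R by (simp add: torsion_group_pow ec_mult_eq_pow)
    then show ?thesis
      using f_mem_of_odd_order[of R j P] torsion_of_dvd[OF R(1,3) m(2)] R(2) P by simp
  qed
  have neg: "ec_neg P \<in> carrier (torsion_group l)" if "P \<in> carrier (torsion_group l)" for P
    using inv_closed[OF that] inv_torsion_group[OF that] by simp
  \<comment> \<open>Multiplied by \<open>xc P - xc Q\<close>, the slopes for \<open>Q\<close> and
    \<open>ec_neg Q\<close> give the difference and the sum of the y-coordinates; \<open>a\<close>
    is then read off from the tangent-type equation.\<close>
  have pair: "yc P \<in> S \<and> a \<in> S"
    if P: "P \<in> carrier (torsion_group l)" "P \<noteq> Infinity"
      and Q: "Q \<in> carrier (torsion_group l)" "Q \<noteq> Infinity" and PQ: "P \<noteq> Q" "P \<noteq> ec_neg Q" for P Q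
  proof -
    have nz: "P \<boxplus> Q \<noteq> Infinity" "P \<boxplus> ec_neg Q \<noteq> Infinity"
      using PQ by (auto simp: ec_add_eq_Infinity_iff)
    have s1: "line_slope a P Q \<in> S" and s2: "line_slope a P (ec_neg Q) \<in> S"
      using slopes[OF P(1) Q(1)] slopes[OF P(1) neg[OF Q(1)]] P Q nz by auto
    have c: "curve P" "curve Q" "curve (ec_neg Q)" using P Q by simp_all
    have eqs: "line_slope a P Q * (xc P - xc Q) = yc P - yc Q"
      "line_slope a P Q * (yc P + yc Q) = xc P ^ 2 + xc P * xc Q + xc Q ^ 2 + a"
      "line_slope a P (ec_neg Q) * (xc P - xc Q) = yc P + yc Q"
      using slope_equations(2,3)[of P Q] slope_equations(2)[of P "ec_neg Q"] c nz P Q by simp_all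
    have m: "yc P - yc Q \<in> S" unfolding eqs(1)[symmetric]
      by (intro alg(2) s1 diff_S x P Q)
    have p: "yc P + yc Q \<in> S" unfolding eqs(3)[symmetric]
      by (intro alg(2) s2 diff_S x P Q)
    have "2 * yc P \<in> S" using alg(1)[OF m p] by simp
    moreover have "line_slope a P Q * (yc P + yc Q)
        - (xc P * xc P + xc P * xc Q + xc Q * xc Q) \<in> S"
      by (rule diff_S[OF alg(2)[OF s1 p]]) (intro alg x P Q)
    then have "a \<in> S" unfolding eqs(2) by (simp add: power2_eq_square)
    ultimately show ?thesis using half_S by blast
  qed
  obtain P Q where PQ: "P \<in> carrier (torsion_group l)" "Q \<in> carrier (torsion_group l)"
    "P \<noteq> Infinity" "Q \<noteq> Infinity" "P \<noteq> Q" "P \<noteq> ec_neg Q"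
    using independent_torsion_points[OF l] by blast
  show a: "a \<in> S" using pair PQ by blast
  show xy: "xc R \<in> S \<and> yc R \<in> S" if R: "R \<in> carrier (torsion_group l)" "R \<noteq> Infinity" for R
  \<comment> \<open>As \<open>P\<close> and \<open>Q\<close> are distinct up to sign, every
    \<open>R\<close> differs up to sign from at least one of them.\<close>
  proof (cases "R = P \<or> R = ec_neg P")
    case True
    then have "R \<noteq> Q" "R \<noteq> ec_neg Q" using PQ by (auto simp: ec_neg_eq_iff)
    then show ?thesis using x[OF R] pair[OF R PQ(2,4)] by blast
  next
    case False
    then show ?thesis using x[OF R] pair[OF R PQ(1,3)] by blast
  qed
  have "yc P * yc P - xc P * (xc P * xc P) - a * xc P \<in> S"
    using xy[OF PQ(1,3)] a by (intro diff_S alg) auto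
  moreover have "yc P ^ 2 = xc P ^ 3 + a * xc P + b"
    using PQ by (cases P) (auto simp: on_curve_Affine)
  ultimately show "b \<in> S" by (simp add: power2_eq_square power3_eq_cube algebra_simps)
qed

end

section \<open>The generic curve\<close>

lemma const_k_0: "const_k 0 = 0"
  and const_k_1: "const_k 1 = 1"
  and const_k_add: "const_k (c + d) = const_k c + const_k d"
  and const_k_mult: "const_k (c * d) = const_k c * const_k d"
  by (simp_all add: const_k_def flip: to_fract_add to_fract_mult to_ac_add to_ac_mult one_pCons)

lemma const_k_eq_0_iff: "const_k c = 0 \<longleftrightarrow> c = 0"
  by (simp add: const_k_def)

lemma const_k_of_nat: "const_k (of_nat n) = of_nat n"
  by (induction n) (simp_all add: const_k_0 const_k_1 const_k_add)

lemma const_k_inverse_of_nat: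
  assumes "of_nat n \<noteq> (0::'k::field)"
  shows "const_k (1 / of_nat n :: 'k) = 1 / of_nat n"
proof -
  have "const_k (1 / of_nat n :: 'k) * of_nat n = 1"
    using assms by (simp add: const_k_1 flip: const_k_mult const_k_of_nat)
  moreover have "(of_nat n :: 'k Kbar) \<noteq> 0"
    using assms by (metis const_k_of_nat const_k_eq_0_iff)
  ultimately show ?thesis by (simp add: field_simps)
qed

lemma indet_disc:
  assumes "(3::'k::field) \<noteq> 0"
  shows "4 * indet_a ^ 3 + 27 * indet_b ^ 2 \<noteq> (0 :: 'k Kbar)"
proof -
  define p :: "'k poly poly" where "p = 4 * [:[:0, 1:]:] ^ 3 + 27 * [:0, 1:] ^ 2"
  have "(27::'k) = 3 * 3 * 3" by simp
  then have "(27::'k) \<noteq> 0" using assms by (metis mult_eq_0_iff)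
  \<comment> \<open>This is the coefficient of the square of the outer variable \<open>b\<close>, in
    degree zero in \<open>a\<close>.\<close>
  moreover have "coeff (coeff p 2) 0 = 27"
    by (simp add: p_def numeral_poly power3_eq_cube power2_eq_square numeral_2_eq_2)
  ultimately have "p \<noteq> 0" by auto
  then have "to_ac (to_fract p) \<noteq> 0" by simp
  moreover have "to_ac (to_fract p) = 4 * indet_a ^ 3 + 27 * indet_b ^ 2"
  proof -
    have "to_fract (of_nat n :: 'k poly poly) = of_nat n" for n
      by (induction n) simp_all
    from this[of 4] this[of 27]
    have num: "to_fract (4 :: 'k poly poly) = 4" "to_fract (27 :: 'k poly poly) = 27" by simp_all
    show ?thesis
      by (simp only: p_def indet_a_def indet_b_def power3_eq_cube power2_eq_square
          to_fract_add to_fract_mult to_ac_add to_ac_mult num to_ac_numeral)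
  qed
  ultimately show ?thesis by simp
qed

theorem theorem3p12:
  fixes l :: nat
  assumes "l \<ge> 3"
    and "(of_nat (6 * l) :: 'k::field) \<noteq> 0"
    and "\<And>z :: 'k alg_closure. z ^ l = 1 \<Longrightarrow> z \<in> range to_ac"
  shows "(indet_a :: 'k Kbar) \<in> slope_alg l \<and>
         (indet_b :: 'k Kbar) \<in> slope_alg l \<and>
         (\<forall>P \<in> (nonzero_torsion l :: 'k Kbar ec_point set).
            xc P \<in> slope_alg l \<and> yc P \<in> slope_alg l) \<and>
         (R_alg l :: 'k Kbar set) = slope_alg l"
proof -
  \<comment> \<open>Covers 2, 3 and \<open>l\<close> at once.\<close>
  have of_nat_ne: "of_nat n \<noteq> (0::'k)" "of_nat n \<noteq> (0 :: 'k Kbar)" if "n dvd 6 * l" for n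
  proof -
    show "of_nat n \<noteq> (0::'k)"
      using that assms(2) by (metis dvdE mult_zero_left of_nat_mult)
    then show "of_nat n \<noteq> (0 :: 'k Kbar)" by (metis const_k_of_nat const_k_eq_0_iff)
  qed
  have two: "(2::'k Kbar) \<noteq> 0" and three: "(3::'k) \<noteq> 0" "(3::'k Kbar) \<noteq> 0"
    using of_nat_ne(2)[of 2] of_nat_ne[of 3] by simp_all
  interpret closed_elliptic_curve "indet_a :: 'k Kbar" indet_b
    by unfold_locales (use indet_disc two three in auto)
  have sub: "k_subalgebra (slope_alg l :: 'k Kbar set)"
    unfolding slope_alg_def by (rule k_subalgebra_hull)
  then have alg: "u + v \<in> slope_alg l" "u * v \<in> slope_alg l"
    if "u \<in> slope_alg l" "v \<in> slope_alg l" for u v :: "'k Kbar"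
    using that by (auto simp: k_subalgebra_def)
  have cst: "const_k c \<in> slope_alg l" for c :: 'k
    using sub by (auto simp: k_subalgebra_def)
  \<comment> \<open>\<open>k_subalgebra\<close> speaks of sums and products only, so differences are
    obtained through the constant -1.\<close>
  have "const_k (-1 :: 'k) + const_k 1 = 0" by (simp add: const_k_0 flip: const_k_add)
  then have m1: "(-1 :: 'k Kbar) \<in> slope_alg l"
    using cst[of "-1"] by (simp add: const_k_1 add_eq_0_iff2)
  have inv: "(1 / of_nat n :: 'k Kbar) \<in> slope_alg l" if "n dvd 6 * l" for n
    using cst[of "1 / of_nat n"] const_k_inverse_of_nat[OF of_nat_ne(1)[OF that]] by metis
  have fractions: "(1 / 2 :: 'k Kbar) \<in> slope_alg l" "(1 / 3 :: 'k Kbar) \<in> slope_alg l"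
    using inv[of 2] inv[of 3] by simp_all
  have tors: "P \<in> nonzero_torsion l \<longleftrightarrow> P \<in> carrier (torsion_group l) \<and> P \<noteq> Infinity"
    for P :: "'k Kbar ec_point"
    by (auto simp: nonzero_torsion_def)
  have slopes: "line_slope indet_a P Q \<in> slope_alg l"
    if "P \<in> carrier (torsion_group l)" "Q \<in> carrier (torsion_group l)"
      "P \<noteq> Infinity" "Q \<noteq> Infinity" "ec_add indet_a P Q \<noteq> Infinity" for P Q :: "'k Kbar ec_point"
  proof -
    interpret T: comm_group "torsion_group l :: 'k Kbar ec_point monoid"
      by (rule comm_group_torsion_group)
    have PQ: "ec_add indet_a P Q \<in> carrier (torsion_group l)" using T.m_closed[OF that(1,2)] by simp
    \<comment> \<open>This is the third point \<open>R\<close> demanded by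
      \<open>torsion_slopes\<close>.\<close>
    then have "ec_neg (ec_add indet_a P Q) \<in> nonzero_torsion l"
      using T.inv_closed[OF PQ] inv_torsion_group[OF PQ] that(5) unfolding tors by simp
    then have "line_slope indet_a P Q \<in> torsion_slopes l"
      unfolding torsion_slopes_def using that tors by force
    then show ?thesis unfolding slope_alg_def by (rule hull_inc)
  qed
  have l_ne: "of_nat l \<noteq> (0 :: 'k Kbar)" by (rule of_nat_ne) simp
  note mem = torsion_coordinates_mem[OF assms(1) l_ne alg m1 fractions slopes]
  have xy: "xc P \<in> slope_alg l" "yc P \<in> slope_alg l" if "P \<in> nonzero_torsion l"
    for P :: "'k Kbar ec_point"
    using mem(1) that tors by blast+
  have "R_alg l = (slope_alg l :: 'k Kbar set)"
  proof
    show "R_alg l \<subseteq> (slope_alg l :: 'k Kbar set)"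
      unfolding R_alg_def
    proof (rule hull_minimal)
      have "torsion_slopes l \<subseteq> (slope_alg l :: 'k Kbar set)"
        unfolding slope_alg_def by (rule hull_subset)
      then show "{indet_a, indet_b} \<union> xc ` nonzero_torsion l \<union> yc ` nonzero_torsion l
          \<union> torsion_slopes l \<subseteq> (slope_alg l :: 'k Kbar set)"
        using mem(2,3) xy by blast
    qed (rule sub)
    show "slope_alg l \<subseteq> (R_alg l :: 'k Kbar set)"
      unfolding R_alg_def slope_alg_def by (rule hull_mono) blast
  qed
  then show ?thesis using mem(2,3) xy by blast
qed

end
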